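(* Let $c_1,c_2,\lambda\in\mathbb{R}$ and let $(M,g)$ be a (pseudo-)Riemannian $n$-manifold with Ricci tensor $R_{ab}$ and scalar curvature $R$. Assume that $$\rho^a{}_b:=(1-c_1c_2)R^a{}_b+\big((n-1)\lambda c_1+c_1c_2R\big)\delta^a{}_b$$ has nowhere-zero determinant, and let $\tilde\rho^a{}_b$ denote its matrix inverse. If $(g,X)$ is a gradient generalised Ricci soliton, then $$X_a=-\frac{c_2}{2}\,\tilde\rho_a{}^b\nabla_bR .$$ The 1-form $X_a$ given by this formula defines a gradient generalised Ricci soliton if and only if it further satisfies $$\nabla_aX_b=-c_1X_aX_b+c_2R_{ab}+\lambda g_{ab}.$$
   Context: A pair $(g,X)$ is a generalised Ricci soliton (with parameters $c_1,c_2,\lambda$) if $\nabla_{(a}X_{b)}+c_1X_aX_b-c_2R_{ab}=\lambda g_{ab}$, where $\nabla$ is the Levi-Civita connection of $g$ and round brackets denote symmetrisation (with factor $\tfrac12$). It is called gradient if moreover $\nabla_{[a}X_{b]}=0$ (so that $X$ is locally a gradient). Indices are raised and lowered with $g$. *)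

theory Defs
  imports "HOL-Analysis.Analysis"
begin

section \<open>Calculus on open subsets of coordinate space\<close>

definition partial :: "'n::finite \<Rightarrow> (real^'n \<Rightarrow> real) \<Rightarrow> real^'n \<Rightarrow> real" where
  "partial i f x = frechet_derivative f (at x) (axis i 1)"

text \<open>\<open>Ck_on k S f\<close> and \<open>smooth_on S f\<close> mean \<open>C\<^sup>k\<close> and \<open>C\<^sup>\<infinity>\<close> regularity for open \<open>S\<close>; they are used
  for open sets only.\<close>

fun Ck_on :: "nat \<Rightarrow> (real^'n::finite) set \<Rightarrow> (real^'n \<Rightarrow> real) \<Rightarrow> bool" where
  "Ck_on 0 S f \<longleftrightarrow> continuous_on S f"
| "Ck_on (Suc k) S f \<longleftrightarrow> f differentiable_on S \<and> (\<forall>i. Ck_on k S (partial i f))"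

definition smooth_on :: "(real^'n::finite) set \<Rightarrow> (real^'n \<Rightarrow> real) \<Rightarrow> bool" where
  "smooth_on S f \<longleftrightarrow> (\<forall>k. Ck_on k S f)"

section \<open>Smooth manifolds\<close>

text \<open>A chart is a pair of its domain in the manifold and its coordinate map.\<close>

type_synonym ('a, 'n) chart = "'a set \<times> ('a \<Rightarrow> real^'n)"

definition chart_image :: "('a, 'n::finite) chart \<Rightarrow> (real^'n) set" where
  "chart_image c = snd c ` fst c"

definition chart_of :: "'a topology \<Rightarrow> ('a, 'n::finite) chart \<Rightarrow> bool" where
  "chart_of M c \<longleftrightarrow> openin M (fst c) \<and> open (chart_image c) \<and>
     homeomorphic_map (subtopology M (fst c)) (top_of_set (chart_image c)) (snd c)"

text \<open>The coordinates of \<open>d\<close> as a function of the coordinates of \<open>c\<close>, meaningful on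
  \<open>overlap c d\<close>, and its Jacobian matrix with entries \<open>\<partial>y\<^sup>k/\<partial>x\<^sup>i\<close>.\<close>

definition overlap :: "('a, 'n::finite) chart \<Rightarrow> ('a, 'n) chart \<Rightarrow> (real^'n) set" where
  "overlap c d = snd c ` (fst c \<inter> fst d)"

definition transition :: "('a, 'n::finite) chart \<Rightarrow> ('a, 'n) chart \<Rightarrow> real^'n \<Rightarrow> real^'n" where
  "transition c d x = snd d (inv_into (fst c) (snd c) x)"

definition jac :: "('a, 'n::finite) chart \<Rightarrow> ('a, 'n) chart \<Rightarrow> 'n \<Rightarrow> 'n \<Rightarrow> real^'n \<Rightarrow> real" where
  "jac c d k i = partial i (\<lambda>x. transition c d x $ k)"

text \<open>The atlas need not be maximal. The dimension of the manifold is \<open>CARD('n)\<close>.\<close>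

definition smooth_manifold :: "'a topology \<Rightarrow> ('a, 'n::finite) chart set \<Rightarrow> bool" where
  "smooth_manifold M A \<longleftrightarrow>
     Hausdorff_space M \<and> second_countable M \<and>
     (\<forall>c\<in>A. chart_of M c) \<and> (\<Union>c\<in>A. fst c) = topspace M \<and>
     (\<forall>c\<in>A. \<forall>d\<in>A. \<forall>k. smooth_on (overlap c d) (\<lambda>x. transition c d x $ k))"

section \<open>Tensor fields\<close>

text \<open>A tensor field is given by its components with respect to every chart of the atlas, as functions
  of the coordinates; components in different charts are related by the tensor transformation law.
  Only the values on \<open>chart_image c\<close> for charts \<open>c\<close> of the atlas matter.\<close>

type_synonym ('a, 'n) covector_field = "('a, 'n) chart \<Rightarrow> real^'n \<Rightarrow> real^'n"
type_synonym ('a, 'n) bilinear_field = "('a, 'n) chart \<Rightarrow> real^'n \<Rightarrow> real^'n^'n"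

definition one_form :: "('a, 'n::finite) chart set \<Rightarrow> ('a, 'n) covector_field \<Rightarrow> bool" where
  "one_form A X \<longleftrightarrow>
     (\<forall>c\<in>A. \<forall>a. smooth_on (chart_image c) (\<lambda>x. X c x $ a)) \<and>
     (\<forall>c\<in>A. \<forall>d\<in>A. \<forall>x\<in>overlap c d. \<forall>a.
        X c x $ a = (\<Sum>k\<in>UNIV. jac c d k a x * X d (transition c d x) $ k))"

definition pseudo_riemannian_metric ::
    "('a, 'n::finite) chart set \<Rightarrow> ('a, 'n) bilinear_field \<Rightarrow> bool" where
  "pseudo_riemannian_metric A g \<longleftrightarrow>
     (\<forall>c\<in>A. \<forall>a b. smooth_on (chart_image c) (\<lambda>x. g c x $ a $ b)) \<and>
     (\<forall>c\<in>A. \<forall>d\<in>A. \<forall>x\<in>overlap c d. \<forall>a b.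
        g c x $ a $ b = (\<Sum>k\<in>UNIV. \<Sum>l\<in>UNIV.
          jac c d k a x * jac c d l b x * g d (transition c d x) $ k $ l)) \<and>
     (\<forall>c\<in>A. \<forall>x\<in>chart_image c. transpose (g c x) = g c x \<and> invertible (g c x))"

section \<open>Curvature in a chart\<close>

text \<open>Here \<open>g\<close> denotes the metric components in one chart. The Levi-Civita connection is given by
  \<open>christoffel g c a b\<close> \<open>= \<Gamma>\<^sup>c\<^sub>a\<^sub>b\<close>.\<close>

definition christoffel ::
    "(real^'n \<Rightarrow> real^'n^'n) \<Rightarrow> 'n::finite \<Rightarrow> 'n \<Rightarrow> 'n \<Rightarrow> real^'n \<Rightarrow> real" where
  "christoffel g c a b x = (1/2) * (\<Sum>d\<in>UNIV. matrix_inv (g x) $ c $ d *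
     (partial a (\<lambda>y. g y $ b $ d) x + partial b (\<lambda>y. g y $ a $ d) x
      - partial d (\<lambda>y. g y $ a $ b) x))"

text \<open>\<open>cov_deriv g X a b\<close> is \<open>\<nabla>\<^sub>aX\<^sub>b\<close>.\<close>

definition cov_deriv ::
    "(real^'n \<Rightarrow> real^'n^'n) \<Rightarrow> (real^'n \<Rightarrow> real^'n) \<Rightarrow> 'n::finite \<Rightarrow> 'n \<Rightarrow> real^'n \<Rightarrow> real" where
  "cov_deriv g X a b x =
     partial a (\<lambda>y. X y $ b) x - (\<Sum>c\<in>UNIV. christoffel g c a b x * X x $ c)"

text \<open>\<open>riemann g a b c d\<close> is \<open>R\<^sub>a\<^sub>b\<^sup>c\<^sub>d\<close> in the convention
  \<open>(\<nabla>\<^sub>a\<nabla>\<^sub>b - \<nabla>\<^sub>b\<nabla>\<^sub>a) V\<^sup>c = R\<^sub>a\<^sub>b\<^sup>c\<^sub>d V\<^sup>d\<close>, and \<open>R\<^sub>b\<^sub>d = R\<^sub>a\<^sub>b\<^sup>a\<^sub>d\<close>, so that round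
  spheres have positive Ricci curvature.\<close>

definition riemann ::
    "(real^'n \<Rightarrow> real^'n^'n) \<Rightarrow> 'n::finite \<Rightarrow> 'n \<Rightarrow> 'n \<Rightarrow> 'n \<Rightarrow> real^'n \<Rightarrow> real" where
  "riemann g a b c d x =
     partial a (christoffel g c b d) x - partial b (christoffel g c a d) x
     + (\<Sum>e\<in>UNIV. christoffel g c a e x * christoffel g e b d x)
     - (\<Sum>e\<in>UNIV. christoffel g c b e x * christoffel g e a d x)"

definition ricci ::
    "(real^'n \<Rightarrow> real^'n^'n) \<Rightarrow> 'n::finite \<Rightarrow> 'n \<Rightarrow> real^'n \<Rightarrow> real" where
  "ricci g b d x = (\<Sum>a\<in>UNIV. riemann g a b a d x)"

text \<open>\<open>ricci_mixed g x $ a $ b\<close> is \<open>R\<^sup>a\<^sub>b\<close>.\<close>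

definition ricci_mixed :: "(real^'n \<Rightarrow> real^'n^'n) \<Rightarrow> real^'n \<Rightarrow> real^'n^'n::finite" where
  "ricci_mixed g x = (\<chi> a b. \<Sum>c\<in>UNIV. matrix_inv (g x) $ a $ c * ricci g c b x)"

definition scalar_curvature :: "(real^'n::finite \<Rightarrow> real^'n^'n) \<Rightarrow> real^'n \<Rightarrow> real" where
  "scalar_curvature g x = (\<Sum>a\<in>UNIV. \<Sum>b\<in>UNIV. matrix_inv (g x) $ a $ b * ricci g a b x)"

section \<open>Generalised Ricci solitons\<close>

definition generalised_ricci_soliton ::
    "('a, 'n::finite) chart set \<Rightarrow> ('a, 'n) bilinear_field \<Rightarrow> real \<Rightarrow> real \<Rightarrow> real \<Rightarrow>
     ('a, 'n) covector_field \<Rightarrow> bool" where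
  "generalised_ricci_soliton A g c1 c2 lam X \<longleftrightarrow> one_form A X \<and>
     (\<forall>c\<in>A. \<forall>x\<in>chart_image c. \<forall>a b.
        (cov_deriv (g c) (X c) a b x + cov_deriv (g c) (X c) b a x) / 2
        + c1 * X c x $ a * X c x $ b - c2 * ricci (g c) a b x = lam * g c x $ a $ b)"

definition gradient_soliton ::
    "('a, 'n::finite) chart set \<Rightarrow> ('a, 'n) bilinear_field \<Rightarrow> real \<Rightarrow> real \<Rightarrow> real \<Rightarrow>
     ('a, 'n) covector_field \<Rightarrow> bool" where
  "gradient_soliton A g c1 c2 lam X \<longleftrightarrow> generalised_ricci_soliton A g c1 c2 lam X \<and>
     (\<forall>c\<in>A. \<forall>x\<in>chart_image c. \<forall>a b.
        (cov_deriv (g c) (X c) a b x - cov_deriv (g c) (X c) b a x) / 2 = 0)"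

text \<open>\<open>rho c1 c2 lam g x $ a $ b\<close> is \<open>\<rho>\<^sup>a\<^sub>b\<close>; \<open>mat 1\<close> is \<open>\<delta>\<^sup>a\<^sub>b\<close>.\<close>

definition rho ::
    "real \<Rightarrow> real \<Rightarrow> real \<Rightarrow> (real^'n \<Rightarrow> real^'n^'n) \<Rightarrow> real^'n \<Rightarrow> real^'n^'n::finite" where
  "rho c1 c2 lam g x = (1 - c1 * c2) *\<^sub>R ricci_mixed g x
     + ((real CARD('n) - 1) * lam * c1 + c1 * c2 * scalar_curvature g x) *\<^sub>R mat 1"

text \<open>\<open>rho_inv_flip c1 c2 lam g x $ a $ b\<close> is the matrix inverse of \<open>\<rho>\<close> with its first index
  lowered and its second index raised: \<open>g\<^sub>a\<^sub>c (\<rho>\<^sup>-\<^sup>1)\<^sup>c\<^sub>d g\<^sup>d\<^sup>b\<close>.\<close>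

definition rho_inv_flip ::
    "real \<Rightarrow> real \<Rightarrow> real \<Rightarrow> (real^'n \<Rightarrow> real^'n^'n) \<Rightarrow> real^'n \<Rightarrow> real^'n^'n::finite" where
  "rho_inv_flip c1 c2 lam g x = g x ** matrix_inv (rho c1 c2 lam g x) ** matrix_inv (g x)"

definition soliton_candidate ::
    "('a, 'n::finite) bilinear_field \<Rightarrow> real \<Rightarrow> real \<Rightarrow> real \<Rightarrow> ('a, 'n) covector_field" where
  "soliton_candidate g c1 c2 lam c x = (\<chi> a. - (c2 / 2) *
     (\<Sum>b\<in>UNIV. rho_inv_flip c1 c2 lam (g c) x $ a $ b * partial b (scalar_curvature (g c)) x))"

end

theory Submission
  imports Defs
begin

text \<open>Everything except the transformation behaviour of the candidate one-form happens inside one chart.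
There a gradient soliton is a covector field \<open>X\<close> with \<open>\<nabla>\<^sub>aX\<^sub>b = S\<^sub>a\<^sub>b\<close>, where
\<open>S\<^sub>a\<^sub>b = - c\<^sub>1 X\<^sub>a X\<^sub>b + c\<^sub>2 R\<^sub>a\<^sub>b + \<lambda> g\<^sub>a\<^sub>b\<close>: the symmetric part of this equation is the soliton equation, and
the skew part is the gradient condition because \<open>S\<close> is symmetric. The equation prescribes all first
derivatives of \<open>X\<close>, so commuting two of them is an integrability condition. Raising an index and
tracing the Ricci identity yields
\<open>div(S)\<^sub>b - \<partial>\<^sub>b tr(S) = R\<^sub>b\<^sub>d X\<^sup>d\<close> (\<open>ricci_identity_contracted\<close>). On the left the derivatives of \<open>X\<close> are
eliminated by the equation itself, and the derivatives of the Ricci tensor combine by the contracted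
Bianchi identity \<open>div(Ric) = dR/2\<close> (\<open>contracted_bianchi\<close>). What remains is the algebraic equation
\<open>X\<^sub>a \<rho>\<^sup>a\<^sub>b = - (c\<^sub>2/2) \<partial>\<^sub>bR\<close> (\<open>soliton_linear_equation\<close>), which determines \<open>X\<close> when \<open>\<rho>\<close> is invertible.
The inverse appears with flipped indices in the formula for the candidate, which is harmless because
\<open>\<rho>\<close> is self-adjoint for \<open>g\<close> (\<open>rho_lowered_symmetric\<close>).

For the converse, the equation \<open>\<nabla>\<^sub>aX\<^sub>b = S\<^sub>a\<^sub>b\<close> splits into its symmetric and skew parts as soon as the Ricci
tensor is known to be symmetric. The remaining point is that the candidate, defined chart by chart,
is one smooth covector field on the manifold. This needs the tensoriality of the Ricci curvature:
the Jacobian of a change of coordinates acts on the connection matrices as a gauge transformation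
(\<open>conn_transform\<close>), so it conjugates the curvature matrices (\<open>gauge_curv\<close>), and tracing gives
\<open>ricci_matrix_transform\<close> and \<open>candidate_transform\<close>.

The tensor calculations are organised by matrices. For fixed directions \<open>a\<close> and \<open>b\<close> the symbols
\<open>\<Gamma>\<^sup>c\<^sub>a\<^sub>d\<close> and \<open>R\<^sub>a\<^sub>b\<^sup>c\<^sub>d\<close> are matrices in \<open>c\<close> and \<open>d\<close>, and metric compatibility, the second Bianchi identity
and the gauge transformation become identities in a noncommutative ring.\<close>

section \<open>Partial derivatives and smooth functions\<close>

lemma partial_cong:
  assumes "open S" "x \<in> S" "\<And>y. y \<in> S \<Longrightarrow> f y = h y"
  shows "partial i f x = partial i h x"
proof -
  have "(f has_derivative D) (at x) \<longleftrightarrow> (h has_derivative D) (at x)" for D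
    using assms by (metis has_derivative_transform_within_open)
  then show ?thesis by (simp add: partial_def frechet_derivative_def)
qed

lemma has_derivative_partial:
  assumes "f differentiable (at x)"
  shows "(f has_derivative (\<lambda>v. \<Sum>i\<in>UNIV. v $ i * partial i f x)) (at x)"
proof -
  let ?D = "frechet_derivative f (at x)"
  have D: "(f has_derivative ?D) (at x)" using assms frechet_derivative_works by blast
  then have lin: "linear ?D" by (rule has_derivative_linear)
  have "?D v = (\<Sum>i\<in>UNIV. v $ i * partial i f x)" for v
  proof -
    have "?D v = ?D (\<Sum>i\<in>UNIV. v $ i *s axis i 1)" by (simp add: basis_expansion)
    also have "\<dots> = (\<Sum>i\<in>UNIV. v $ i * partial i f x)"
      by (simp add: linear_sum[OF lin] scalar_mult_eq_scaleR linear_cmul[OF lin] partial_def)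
    finally show ?thesis .
  qed
  then have "?D = (\<lambda>v. \<Sum>i\<in>UNIV. v $ i * partial i f x)" by (rule ext)
  then show ?thesis using D by simp
qed

lemma partial_eqI: "(f has_derivative D) (at x) \<Longrightarrow> partial i f x = D (axis i 1)"
  unfolding partial_def by (metis frechet_derivative_at)

lemma partial_const [simp]: "partial i (\<lambda>x. c) x = 0"
  by (simp add: partial_def)

lemma partial_add:
  assumes "f differentiable (at x)" "h differentiable (at x)"
  shows "partial i (\<lambda>x. f x + h x) x = partial i f x + partial i h x"
  using assms partial_eqI[OF has_derivative_add[OF frechet_derivative_works[THEN iffD1]
      frechet_derivative_works[THEN iffD1]]]
  by (simp add: partial_def)

lemma partial_mult:
  assumes "f differentiable (at x)" "h differentiable (at x)"
  shows "partial i (\<lambda>x. f x * h x) x = partial i f x * h x + f x * partial i h x"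
  using assms partial_eqI[OF has_derivative_mult[OF frechet_derivative_works[THEN iffD1]
      frechet_derivative_works[THEN iffD1]]]
  by (simp add: partial_def add.commute)

lemma partial_sum:
  assumes "\<And>k. k \<in> I \<Longrightarrow> f k differentiable (at x)"
  shows "partial i (\<lambda>x. \<Sum>k\<in>I. f k x) x = (\<Sum>k\<in>I. partial i (f k) x)"
  unfolding partial_def[of _ "f _"]
  by (rule partial_eqI, rule has_derivative_sum) (use assms frechet_derivative_works in blast)

lemma partial_cmult:
  assumes "f differentiable (at x)"
  shows "partial i (\<lambda>x. c * f x) x = c * partial i f x"
  using partial_mult[of "\<lambda>x. c", OF _ assms] by simp

lemma partial_diff:
  assumes "f differentiable (at x)" "h differentiable (at x)"
  shows "partial i (\<lambda>x. f x - h x) x = partial i f x - partial i h x"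
  using assms partial_eqI[OF has_derivative_diff[OF frechet_derivative_works[THEN iffD1]
      frechet_derivative_works[THEN iffD1]]]
  by (simp add: partial_def)

lemma partial_inverse:
  assumes "f differentiable (at x)" "f x \<noteq> (0::real)"
  shows "partial i (\<lambda>x. inverse (f x)) x = - (partial i f x * (inverse (f x) * inverse (f x)))"
  using partial_eqI[OF Deriv.has_derivative_inverse[OF assms(2) assms(1)[unfolded
      frechet_derivative_works]], of i]
  by (simp add: partial_def mult_ac)

lemma chain_rule_partial:
  fixes \<phi> :: "real^'n::finite \<Rightarrow> real^'n"
  assumes f: "f differentiable (at (\<phi> x))" and \<phi>: "\<And>k. (\<lambda>y. \<phi> y $ k) differentiable (at x)"
  shows "(\<lambda>y. f (\<phi> y)) differentiable (at x)"
    and "partial i (\<lambda>y. f (\<phi> y)) x = (\<Sum>k\<in>UNIV. partial i (\<lambda>y. \<phi> y $ k) x * partial k f (\<phi> x))"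
proof -
  have "((\<lambda>y. \<phi> y) has_derivative (\<lambda>v. \<chi> k. frechet_derivative (\<lambda>y. \<phi> y $ k) (at x) v)) (at x)"
    by (subst has_derivative_componentwise_within)
      (use \<phi> in \<open>auto simp: Basis_vec_def inner_axis frechet_derivative_works\<close>)
  note c = has_derivative_compose[OF this has_derivative_partial[OF f]]
  show "(\<lambda>y. f (\<phi> y)) differentiable (at x)" using c by (auto simp: differentiable_def)
  show "partial i (\<lambda>y. f (\<phi> y)) x = (\<Sum>k\<in>UNIV. partial i (\<lambda>y. \<phi> y $ k) x * partial k f (\<phi> x))"
    using partial_eqI[OF c] by (simp add: partial_def)
qed

lemma Ck_on_cong:
  assumes "open S" "\<And>x. x \<in> S \<Longrightarrow> f x = h x"
  shows "Ck_on k S f \<longleftrightarrow> Ck_on k S h"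
  using assms(2)
proof (induction k arbitrary: f h)
  case 0
  then show ?case by (simp cong: continuous_on_cong)
next
  case (Suc k)
  have "f differentiable_on S \<longleftrightarrow> h differentiable_on S"
    using Suc.prems by (auto simp: differentiable_on_def intro: differentiable_transform_within[OF _
        zero_less_one])
  moreover have "Ck_on k S (partial i f) \<longleftrightarrow> Ck_on k S (partial i h)" for i
    by (intro Suc.IH partial_cong[OF assms(1)] Suc.prems)
  ultimately show ?case by simp
qed

lemma smooth_on_cong:
  "open S \<Longrightarrow> (\<And>x. x \<in> S \<Longrightarrow> f x = h x) \<Longrightarrow> smooth_on S f \<longleftrightarrow> smooth_on S h"
  unfolding smooth_on_def using Ck_on_cong by metis

lemma smooth_on_partial: "smooth_on S f \<Longrightarrow> smooth_on S (partial i f)"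
  unfolding smooth_on_def by (metis Ck_on.simps(2))

lemma smooth_on_differentiable: "smooth_on S f \<Longrightarrow> open S \<Longrightarrow> x \<in> S \<Longrightarrow> f differentiable (at x)"
  by (metis Ck_on.simps(2) at_within_open differentiable_on_def smooth_on_def)

lemma Ck_on_Suc_D: "Ck_on (Suc k) S f \<Longrightarrow> Ck_on k S f"
  by (induction k arbitrary: f) (auto intro: differentiable_imp_continuous_on)

lemma Ck_on_const: "Ck_on k (S :: (real^'n::finite) set) (\<lambda>x. c)"
proof (induction k arbitrary: c)
  case (Suc k)
  have "partial i (\<lambda>x. c) = (\<lambda>x. 0)" for i :: 'n by (rule ext) simp
  then show ?case using Suc by simp
qed simp

lemma differentiable_on_openD: "f differentiable_on S \<Longrightarrow> open S \<Longrightarrow> x \<in> S \<Longrightarrow> f differentiable (at x)"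
  by (metis at_within_open differentiable_on_def)

lemma Ck_on_add: "open S \<Longrightarrow> Ck_on k S f \<Longrightarrow> Ck_on k S h \<Longrightarrow> Ck_on k S (\<lambda>x. f x + h x)"
proof (induction k arbitrary: f h)
  case (Suc k)
  note d = differentiable_on_openD[OF _ Suc.prems(1)]
  have "Ck_on k S (\<lambda>x. partial i f x + partial i h x)" for i
    using Suc.prems by (intro Suc.IH) simp_all
  then have "Ck_on k S (partial i (\<lambda>x. f x + h x))" for i
    using Suc.prems by (subst Ck_on_cong[OF Suc.prems(1) partial_add]) (simp_all add: d)
  then show ?case using Suc.prems by (simp add: differentiable_on_def)
qed (simp add: continuous_on_add)

lemma Ck_on_mult: "open S \<Longrightarrow> Ck_on k S f \<Longrightarrow> Ck_on k S h \<Longrightarrow> Ck_on k S (\<lambda>x. f x * h x)"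
proof (induction k arbitrary: f h)
  case (Suc k)
  note d = differentiable_on_openD[OF _ Suc.prems(1)]
  have "Ck_on k S (\<lambda>x. partial i f x * h x + f x * partial i h x)" for i
    using Suc.prems(2,3) Suc.prems(2,3)[THEN Ck_on_Suc_D]
    by (intro Ck_on_add Suc.IH Suc.prems(1)) simp_all
  then have "Ck_on k S (partial i (\<lambda>x. f x * h x))" for i
    using Suc.prems by (subst Ck_on_cong[OF Suc.prems(1) partial_mult]) (simp_all add: d)
  then show ?case using Suc.prems by (simp add: differentiable_on_def)
qed (simp add: continuous_on_mult)

lemma Ck_on_inverse:
  "open S \<Longrightarrow> (\<And>x. x \<in> S \<Longrightarrow> f x \<noteq> 0) \<Longrightarrow> Ck_on k S f \<Longrightarrow> Ck_on k S (\<lambda>x. inverse (f x))"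
proof (induction k)
  case (Suc k)
  note d = differentiable_on_openD[OF _ Suc.prems(1)]
  have inv: "Ck_on k S (\<lambda>x. inverse (f x))"
    using Suc.prems(3)[THEN Ck_on_Suc_D] by (intro Suc.IH Suc.prems)
  have "Ck_on k S (\<lambda>x. - 1 * (partial i f x * (inverse (f x) * inverse (f x))))" for i
    using Suc.prems(3) by (intro Ck_on_mult inv Ck_on_const Suc.prems(1)) simp_all
  then have "Ck_on k S (partial i (\<lambda>x. inverse (f x)))" for i
    using Suc.prems by (subst Ck_on_cong[OF Suc.prems(1) partial_inverse]) (simp_all add: d)
  then show ?case using Suc.prems by (simp add: differentiable_on_def)
qed (simp add: continuous_on_inverse)

lemma smooth_on_const: "smooth_on S (\<lambda>x. c)"
  by (simp add: smooth_on_def Ck_on_const)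

lemma smooth_on_add: "open S \<Longrightarrow> smooth_on S f \<Longrightarrow> smooth_on S h \<Longrightarrow> smooth_on S (\<lambda>x. f x + h x)"
  by (simp add: smooth_on_def Ck_on_add)

lemma smooth_on_mult: "open S \<Longrightarrow> smooth_on S f \<Longrightarrow> smooth_on S h \<Longrightarrow> smooth_on S (\<lambda>x. f x * h x)"
  by (simp add: smooth_on_def Ck_on_mult)

lemma smooth_on_diff:
  assumes "open S" "smooth_on S f" "smooth_on S h"
  shows "smooth_on S (\<lambda>x. f x - h x)"
  using smooth_on_add[OF assms(1,2) smooth_on_mult[OF assms(1) smooth_on_const[of _ "- 1"]
      assms(3)]] by simp

lemma smooth_on_divide:
  assumes "open S" "smooth_on S f" "smooth_on S h" "\<And>x. x \<in> S \<Longrightarrow> h x \<noteq> 0"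
  shows "smooth_on S (\<lambda>x. f x / h x)"
  unfolding divide_inverse using assms
      by (auto simp: smooth_on_def intro!: Ck_on_mult Ck_on_inverse)

lemma smooth_on_sum:
  "open S \<Longrightarrow> (\<And>k. k \<in> I \<Longrightarrow> smooth_on S (f k)) \<Longrightarrow> smooth_on S (\<lambda>x. \<Sum>k\<in>I. f k x)"
  by (induction I rule: infinite_finite_induct) (auto intro: smooth_on_add smooth_on_const)

lemma smooth_on_prod:
  "open S \<Longrightarrow> (\<And>k. k \<in> I \<Longrightarrow> smooth_on S (f k)) \<Longrightarrow> smooth_on S (\<lambda>x. \<Prod>k\<in>I. f k x)"
  by (induction I rule: infinite_finite_induct) (auto intro: smooth_on_mult smooth_on_const)

text \<open>Two applications of the mean value theorem, first in direction \<open>i\<close> and then in direction \<open>j\<close>. The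
second difference on the left is symmetric in \<open>i\<close> and \<open>j\<close>, which is what forces mixed partial derivatives
to agree.\<close>

lemma second_difference_mvt:
  fixes f :: "real^'n::finite \<Rightarrow> real"
  assumes S: "open S" "smooth_on S f" and h: "0 < h" and ball: "ball x r \<subseteq> S" and r: "2 * h < r"
  shows "\<exists>p. dist x p \<le> 2 * h \<and>
    f (x + h *\<^sub>R axis i 1 + h *\<^sub>R axis j 1) - f (x + h *\<^sub>R axis i 1) - f (x + h *\<^sub>R axis j 1) + f x
      = h * h * partial j (partial i f) p"
proof -
  define q where "q t s = x + t *\<^sub>R axis i 1 + s *\<^sub>R (axis j 1 :: real^'n)" for t s
  have dq: "dist x (q t s) \<le> 2 * h" if "0 \<le> t" "t \<le> h" "0 \<le> s" "s \<le> h" for t s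
  proof -
    have "dist x (q t s) = norm (t *\<^sub>R axis i 1 + s *\<^sub>R (axis j 1 :: real^'n))"
      unfolding q_def dist_norm by (metis add.assoc add_diff_cancel_left' norm_minus_commute)
    also have "\<dots> \<le> t + s" using that by (intro norm_triangle_le) simp
    finally show ?thesis using that by simp
  qed
  have qS: "q t s \<in> S" if "0 \<le> t" "t \<le> h" "0 \<le> s" "s \<le> h" for t s
    using dq[OF that] r ball by (auto simp: subset_iff)
  have di: "((\<lambda>t. k (q t s)) has_real_derivative partial i k (q t s)) (at t)"
    if "smooth_on S k" "q t s \<in> S" for k t s
  proof -
    have "((\<lambda>t. q t s) has_derivative (\<lambda>u. u *\<^sub>R axis i 1)) (at t)"
      unfolding q_def by (auto intro!: derivative_eq_intros)
    from has_derivative_compose[OF this has_derivative_partial[OF smooth_on_differentiable[OF that(1) S(1) that(2)]]]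
    show ?thesis
      by (simp add: has_field_derivative_def axis_def if_distrib[of "\<lambda>z. _ * z * _"] cong: if_cong)
        (simp add: mult_commute_abs)
  qed
  have dj: "((\<lambda>s. k (q t s)) has_real_derivative partial j k (q t s)) (at s)"
    if "smooth_on S k" "q t s \<in> S" for k t s
  proof -
    have "((\<lambda>s. q t s) has_derivative (\<lambda>u. u *\<^sub>R axis j 1)) (at s)"
      unfolding q_def by (auto intro!: derivative_eq_intros)
    from has_derivative_compose[OF this has_derivative_partial[OF smooth_on_differentiable[OF that(1) S(1) that(2)]]]
    show ?thesis
      by (simp add: has_field_derivative_def axis_def if_distrib[of "\<lambda>z. _ * z * _"] cong: if_cong)
        (simp add: mult_commute_abs)
  qed
  have mi: "((\<lambda>t. f (q t h) - f (q t 0)) has_real_derivative partial i f (q t h)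
      - partial i f (q t 0)) (at t)"
    if "0 \<le> t" "t \<le> h" for t
    using that h S(2) by (intro DERIV_diff di qS) simp_all
  obtain t where t: "0 < t" "t < h"
    and te: "(f (q h h) - f (q h 0)) - (f (q 0 h) - f (q 0 0)) = (h - 0) * (partial i f (q t h)
        - partial i f (q t 0))"
    using MVT2[OF h mi] by blast
  have mj: "((\<lambda>s. partial i f (q t s)) has_real_derivative partial j (partial i f) (q t s)) (at s)"
    if "0 \<le> s" "s \<le> h" for s
    using that t smooth_on_partial[OF S(2)] by (intro dj qS) simp_all
  obtain s where s: "0 < s" "s < h"
    and se: "partial i f (q t h) - partial i f (q t 0) = (h - 0) * partial j (partial i f) (q t s)"
    using MVT2[OF h mj] by blast
  show ?thesis
    using te se dq[of t s] t s by (intro exI[of _ "q t s"]) (simp add: q_def)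
qed

text \<open>If the two mixed derivatives differed at \<open>x\<close>, then by continuity they would take disjoint sets of values
near \<open>x\<close>; yet a small second difference, divided by \<open>h\<^sup>2\<close>, is a value of both.\<close>

lemma partial_commute:
  fixes f :: "real^'n::finite \<Rightarrow> real"
  assumes S: "open S" "smooth_on S f" and x: "x \<in> S"
  shows "partial i (partial j f) x = partial j (partial i f) x"
proof (rule ccontr)
  define A where "A = partial i (partial j f)"
  define B where "B = partial j (partial i f)"
  assume "partial i (partial j f) x \<noteq> partial j (partial i f) x"
  then have e: "0 < dist (A x) (B x) / 2" (is "0 < ?e") by (simp add: A_def B_def)
  have sm: "smooth_on S A" "smooth_on S B"
    using S(2) by (auto simp: A_def B_def intro: smooth_on_partial)
  then have cont: "isCont A x" "isCont B x"
    using S(1) x by (auto intro: differentiable_imp_continuous_within smooth_on_differentiable)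
  obtain d1 where d1: "d1 > 0" "\<And>y. dist y x < d1 \<Longrightarrow> dist (A y) (A x) < ?e"
    using continuous_at_eps_delta[THEN iffD1, OF cont(1), rule_format, OF e] by blast
  obtain d2 where d2: "d2 > 0" "\<And>y. dist y x < d2 \<Longrightarrow> dist (B y) (B x) < ?e"
    using continuous_at_eps_delta[THEN iffD1, OF cont(2), rule_format, OF e] by blast
  obtain r where r: "r > 0" "ball x r \<subseteq> S" using S(1) x openE by blast
  define h where "h = min r (min d1 d2) / 3"
  have h: "0 < h" "2 * h < r" "2 * h < d1" "2 * h < d2" using d1(1) d2(1) r(1) by (auto simp: h_def)
  obtain p where p: "dist x p \<le> 2 * h"
    "f (x + h *\<^sub>R axis i 1 + h *\<^sub>R axis j 1) - f (x + h *\<^sub>R axis i 1) - f (x + h *\<^sub>R axis j 1) + f x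
        = h * h * B p"
    using second_difference_mvt[OF S h(1) r(2) h(2), of i j] unfolding B_def by blast
  obtain q where q: "dist x q \<le> 2 * h"
    "f (x + h *\<^sub>R axis j 1 + h *\<^sub>R axis i 1) - f (x + h *\<^sub>R axis j 1) - f (x + h *\<^sub>R axis i 1) + f x
        = h * h * A q"
    using second_difference_mvt[OF S h(1) r(2) h(2), of j i] unfolding A_def by blast
  have sw: "x + h *\<^sub>R axis j 1 + h *\<^sub>R axis i 1 = x + h *\<^sub>R axis i 1 + h *\<^sub>R axis j 1"
    by (simp add: add_ac)
  have "h * h * B p = h * h * A q" using p(2) q(2) unfolding sw by linarith
  then have "A q = B p" using h(1) by simp
  moreover have "dist (A q) (A x) < ?e" "dist (B p) (B x) < ?e"
    using d1(2)[of q] d2(2)[of p] p(1) q(1) h by (simp_all add: dist_commute)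
  ultimately show False using dist_triangle2[of "A x" "B x" "B p"] by (simp add: dist_commute)
qed

section \<open>Matrix-valued functions\<close>

lemma matrix_diff_ldistrib: "A ** (B - C) = A ** B - A ** (C :: real^'n^'n::finite)"
  by (vector matrix_matrix_mult_def sum_subtractf right_diff_distrib)

lemma matrix_diff_rdistrib: "(B - C) ** A = B ** A - (C :: real^'n^'n::finite) ** A"
  by (vector matrix_matrix_mult_def sum_subtractf left_diff_distrib)

lemma matrix_add_rdistrib: "(B + C) ** A = B ** A + (C :: real^'n^'n::finite) ** A"
  by (vector matrix_matrix_mult_def sum.distrib distrib_right)

lemma transpose_add: "transpose (A + B) = transpose A + transpose (B :: real^'n^'n::finite)"
  by (vector transpose_def)

lemma transpose_diff: "transpose (A - B) = transpose A - transpose (B :: real^'n^'n::finite)"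
  by (vector transpose_def)

lemmas matrix_ring_simps =
  matrix_mul_assoc matrix_diff_ldistrib matrix_diff_rdistrib matrix_add_ldistrib matrix_add_rdistrib

lemma matrix_inv_left_right:
  assumes "invertible (A :: real^'n^'n::finite)"
  shows "A ** matrix_inv A = mat 1" "matrix_inv A ** A = mat 1"
proof -
  have "A ** matrix_inv A = mat 1 \<and> matrix_inv A ** A = mat 1"
    unfolding matrix_inv_def using assms unfolding invertible_def by (rule someI_ex)
  then show "A ** matrix_inv A = mat 1" "matrix_inv A ** A = mat 1" by auto
qed

lemma matrix_inv_unique:
  assumes "A ** B = mat 1"
  shows "matrix_inv A = (B :: real^'n^'n::finite)"
proof -
  have "invertible A" using assms invertible_right_inverse by blast
  then have "matrix_inv A ** (A ** B) = B" by (simp add: matrix_mul_assoc matrix_inv_left_right)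
  then show ?thesis by (simp add: assms)
qed

lemma matrix_left_cancel:
  assumes "invertible (A :: real^'n^'n::finite)" "A ** B = A ** C"
  shows "B = C"
  using arg_cong[OF assms(2), of "\<lambda>Z. matrix_inv A ** Z"]
  by (simp add: matrix_mul_assoc matrix_inv_left_right[OF assms(1)])

lemma matrix_inv_symmetric:
  assumes "invertible (A :: real^'n^'n::finite)" "transpose A = A"
  shows "transpose (matrix_inv A) = matrix_inv A"
  by (metis assms matrix_inv_left_right(2) matrix_inv_unique matrix_transpose_mul transpose_mat)

definition matrix_partial :: "'n::finite \<Rightarrow> (real^'n \<Rightarrow> real^'n^'n) \<Rightarrow> real^'n \<Rightarrow> real^'n^'n" where
  "matrix_partial a F x = (\<chi> c b. partial a (\<lambda>y. F y $ c $ b) x)"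

definition matrix_differentiable :: "(real^'n::finite \<Rightarrow> real^'n^'n) \<Rightarrow> real^'n \<Rightarrow> bool" where
  "matrix_differentiable F x \<longleftrightarrow> (\<forall>c b. (\<lambda>y. F y $ c $ b) differentiable (at x))"

definition smooth_matrix_on :: "(real^'n::finite) set \<Rightarrow> (real^'n \<Rightarrow> real^'n^'n) \<Rightarrow> bool" where
  "smooth_matrix_on S F \<longleftrightarrow> (\<forall>c b. smooth_on S (\<lambda>y. F y $ c $ b))"

lemma smooth_matrix_onD: "smooth_matrix_on S F \<Longrightarrow> smooth_on S (\<lambda>y. F y $ c $ b)"
  by (simp add: smooth_matrix_on_def)

lemma smooth_matrix_on_differentiable:
  "smooth_matrix_on S F \<Longrightarrow> open S \<Longrightarrow> x \<in> S \<Longrightarrow> matrix_differentiable F x"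
  unfolding smooth_matrix_on_def matrix_differentiable_def using smooth_on_differentiable by blast

lemma matrix_differentiable_mult:
  "matrix_differentiable F x \<Longrightarrow> matrix_differentiable G x \<Longrightarrow> matrix_differentiable (\<lambda>y. F y ** G y) x"
  by (simp add: matrix_differentiable_def matrix_matrix_mult_def)

lemma matrix_differentiable_transpose:
  "matrix_differentiable F x \<Longrightarrow> matrix_differentiable (\<lambda>y. transpose (F y)) x"
  by (simp add: matrix_differentiable_def transpose_def)

lemma matrix_partial_mult:
  "matrix_differentiable F x \<Longrightarrow> matrix_differentiable G x \<Longrightarrow>
    matrix_partial a (\<lambda>y. F y ** G y) x = matrix_partial a F x ** G x + F x ** matrix_partial a G x"
  by (simp add: matrix_differentiable_def matrix_matrix_mult_def matrix_partial_def vec_eq_iff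
      partial_sum partial_mult sum.distrib)

lemma matrix_partial_add:
  "matrix_differentiable F x \<Longrightarrow> matrix_differentiable G x \<Longrightarrow>
    matrix_partial a (\<lambda>y. F y + G y) x = matrix_partial a F x + matrix_partial a G x"
  by (simp add: matrix_differentiable_def matrix_partial_def vec_eq_iff partial_add)

lemma matrix_differentiable_add:
  "matrix_differentiable F x \<Longrightarrow> matrix_differentiable G x \<Longrightarrow> matrix_differentiable (\<lambda>y. F y + G y) x"
  by (simp add: matrix_differentiable_def)

lemma matrix_partial_diff:
  "matrix_differentiable F x \<Longrightarrow> matrix_differentiable G x \<Longrightarrow>
    matrix_partial a (\<lambda>y. F y - G y) x = matrix_partial a F x - matrix_partial a G x"
  by (simp add: matrix_differentiable_def matrix_partial_def vec_eq_iff partial_diff)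

lemma matrix_differentiable_diff:
  "matrix_differentiable F x \<Longrightarrow> matrix_differentiable G x \<Longrightarrow> matrix_differentiable (\<lambda>y. F y - G y) x"
  by (simp add: matrix_differentiable_def)

lemma matrix_partial_transpose: "matrix_partial a (\<lambda>y. transpose (F y)) x
    = transpose (matrix_partial a F x)"
  by (simp add: matrix_partial_def transpose_def)

lemma matrix_partial_const: "matrix_partial a (\<lambda>y. C) x = 0"
  by (simp add: matrix_partial_def vec_eq_iff)

lemma matrix_partial_cong:
  "open S \<Longrightarrow> x \<in> S \<Longrightarrow> (\<And>y. y \<in> S \<Longrightarrow> F y = G y) \<Longrightarrow> matrix_partial a F x = matrix_partial a G x"
  by (simp add: matrix_partial_def vec_eq_iff, intro allI partial_cong) auto

lemma matrix_partial_commute: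
  "open S \<Longrightarrow> smooth_matrix_on S F \<Longrightarrow> x \<in> S \<Longrightarrow>
    matrix_partial a (matrix_partial b F) x = matrix_partial b (matrix_partial a F) x"
  by (simp add: matrix_partial_def vec_eq_iff smooth_matrix_on_def partial_commute)

lemma smooth_matrix_on_partial: "smooth_matrix_on S F \<Longrightarrow> smooth_matrix_on S (matrix_partial a F)"
  by (simp add: matrix_partial_def smooth_matrix_on_def smooth_on_partial)

lemma smooth_matrix_on_mult:
  "open S \<Longrightarrow> smooth_matrix_on S F \<Longrightarrow> smooth_matrix_on S G \<Longrightarrow> smooth_matrix_on S (\<lambda>y. F y ** G y)"
  by (simp add: smooth_matrix_on_def matrix_matrix_mult_def smooth_on_sum smooth_on_mult)

lemma smooth_matrix_on_add:
  "open S \<Longrightarrow> smooth_matrix_on S F \<Longrightarrow> smooth_matrix_on S G \<Longrightarrow> smooth_matrix_on S (\<lambda>y. F y + G y)"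
  by (simp add: smooth_matrix_on_def smooth_on_add)

lemma smooth_matrix_on_diff:
  "open S \<Longrightarrow> smooth_matrix_on S F \<Longrightarrow> smooth_matrix_on S G \<Longrightarrow> smooth_matrix_on S (\<lambda>y. F y - G y)"
  by (simp add: smooth_matrix_on_def smooth_on_diff)

lemma smooth_on_det:
  assumes "open S" "smooth_matrix_on S F"
  shows "smooth_on S (\<lambda>x. det (F x))"
  unfolding det_def using assms
  by (intro smooth_on_sum smooth_on_mult smooth_on_const smooth_on_prod smooth_matrix_onD)

text \<open>Cramer's rule exhibits the entries of the inverse as rational functions of the entries of the matrix,
whence the inverse of a smooth matrix field is smooth.\<close>

lemma matrix_inv_cramer:
  assumes "invertible (A :: real^'n^'n::finite)"
  shows "matrix_inv A $ i $ j = det (\<chi> r s. if s = i then axis j 1 $ r else A $ r $ s) / det A"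
proof -
  have "A *v column j (matrix_inv A) = axis j 1"
    using matrix_inv_left_right(1)[OF assms]
    by (metis matrix_vector_mul_assoc matrix_vector_mul_lid matrix_vector_mult_basis)
  then have "column j (matrix_inv A) = (\<chi> k. det (\<chi> r s. if s
      = k then axis j 1 $ r else A $ r $ s) / det A)"
    using cramer[of A] assms invertible_det_nz by blast
  then show ?thesis by (simp add: column_def vec_eq_iff)
qed

lemma smooth_matrix_on_inv:
  assumes S: "open S" "smooth_matrix_on S F" and inv: "\<And>x. x \<in> S \<Longrightarrow> invertible (F x)"
  shows "smooth_matrix_on S (\<lambda>x. matrix_inv (F x))"
  unfolding smooth_matrix_on_def
proof (intro allI)
  fix i j
  have num: "smooth_matrix_on S (\<lambda>x. \<chi> r s. if s = i then axis j 1 $ r else F x $ r $ s)"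
    unfolding smooth_matrix_on_def
  proof (intro allI)
    fix r s
    show "smooth_on S (\<lambda>x. (\<chi> r s. if s = i then axis j 1 $ r else F x $ r $ s) $ r $ s)"
      using smooth_matrix_onD[OF S(2)] by (cases "s = i") (simp_all add: smooth_on_const)
  qed
  have "smooth_on S (\<lambda>x. det (\<chi> r s. if s = i then axis j 1 $ r else F x $ r $ s) / det (F x))"
    using S inv by (intro smooth_on_divide smooth_on_det num) (simp_all add: invertible_det_nz)
  then show "smooth_on S (\<lambda>x. matrix_inv (F x) $ i $ j)"
    by (rule smooth_on_cong[OF S(1), THEN iffD1, rotated]) (simp add: matrix_inv_cramer inv)
qed

section \<open>Connection and curvature in a chart\<close>

text \<open>The matrix \<open>\<Gamma>\<^sub>a\<close> of the connection form in direction \<open>a\<close>: row \<open>c\<close> and column \<open>b\<close> hold \<open>\<Gamma>\<^sup>c\<^sub>a\<^sub>b\<close>.\<close>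

definition conn_matrix :: "(real^'n \<Rightarrow> real^'n^'n) \<Rightarrow> 'n::finite \<Rightarrow> real^'n \<Rightarrow> real^'n^'n" where
  "conn_matrix g a x = (\<chi> c b. christoffel g c a b x)"

definition curv_matrix :: "(real^'n \<Rightarrow> real^'n^'n) \<Rightarrow> 'n::finite \<Rightarrow> 'n \<Rightarrow> real^'n \<Rightarrow> real^'n^'n" where
  "curv_matrix g a b x = (\<chi> c d. riemann g a b c d x)"

definition ricci_matrix :: "(real^'n \<Rightarrow> real^'n^'n) \<Rightarrow> real^'n \<Rightarrow> real^'n^'n::finite" where
  "ricci_matrix g x = (\<chi> a b. ricci g a b x)"

text \<open>The curvature as \<open>d\<Gamma> + \<Gamma> \<and> \<Gamma>\<close>, which makes it accessible to the matrix calculus.\<close>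

lemma curv_eq:
  "curv_matrix g a b x = matrix_partial a (conn_matrix g b) x - matrix_partial b (conn_matrix g a) x
     + conn_matrix g a x ** conn_matrix g b x - conn_matrix g b x ** conn_matrix g a x"
  by (simp add: curv_matrix_def riemann_def conn_matrix_def matrix_partial_def
      matrix_matrix_mult_def vec_eq_iff)

lemma ricci_matrix_eq: "ricci_matrix g x $ b $ d = (\<Sum>a\<in>UNIV. curv_matrix g a b x $ a $ d)"
  by (simp add: ricci_matrix_def ricci_def curv_matrix_def)

lemma ricci_mixed_eq: "ricci_mixed g x = matrix_inv (g x) ** ricci_matrix g x"
  by (simp add: ricci_mixed_def ricci_matrix_def matrix_matrix_mult_def)

locale metric_on =
  fixes S :: "(real^'n::finite) set" and g :: "real^'n \<Rightarrow> real^'n^'n"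
  assumes open_S: "open S"
    and smooth_g: "smooth_matrix_on S g"
    and symmetric_g: "x \<in> S \<Longrightarrow> transpose (g x) = g x"
    and invertible_g: "x \<in> S \<Longrightarrow> invertible (g x)"
begin

lemma smooth_ginv: "smooth_matrix_on S (\<lambda>x. matrix_inv (g x))"
  using open_S smooth_g invertible_g by (rule smooth_matrix_on_inv)

lemma smooth_conn: "smooth_matrix_on S (conn_matrix g a)"
  unfolding smooth_matrix_on_def conn_matrix_def christoffel_def vec_lambda_beta
  by (intro allI open_S smooth_on_mult smooth_on_const smooth_on_sum
      smooth_matrix_onD[OF smooth_ginv]
      smooth_on_diff smooth_on_add smooth_on_partial smooth_matrix_onD[OF smooth_g])

lemma smooth_curv: "smooth_matrix_on S (curv_matrix g a b)"
  unfolding curv_eq[abs_def] using open_S smooth_conn smooth_matrix_on_partial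
  by (intro smooth_matrix_on_diff smooth_matrix_on_add smooth_matrix_on_mult) auto

lemma smooth_ricci_matrix: "smooth_matrix_on S (ricci_matrix g)"
  unfolding smooth_matrix_on_def ricci_matrix_eq
  using open_S smooth_curv by (intro allI smooth_on_sum smooth_matrix_onD) auto

lemma smooth_ricci_mixed: "smooth_matrix_on S (ricci_mixed g)"
  unfolding ricci_mixed_eq[abs_def]
      by (intro smooth_matrix_on_mult open_S smooth_ginv smooth_ricci_matrix)

lemma g_sym: "x \<in> S \<Longrightarrow> g x $ a $ b = g x $ b $ a"
  using symmetric_g[of x] by (simp add: transpose_def vec_eq_iff)

lemma partial_g_sym: "x \<in> S \<Longrightarrow> partial c (\<lambda>y. g y $ a $ b) x = partial c (\<lambda>y. g y $ b $ a) x"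
  using open_S by (rule partial_cong) (auto intro: g_sym)

lemma christoffel_lowered:
  assumes "x \<in> S"
  shows "(g x ** conn_matrix g a x) $ d $ b =
    (partial a (\<lambda>y. g y $ b $ d) x + partial b (\<lambda>y. g y $ a $ d) x
        - partial d (\<lambda>y. g y $ a $ b) x) / 2"
proof -
  define B :: "real^'n^'n" where "B = (\<chi> d b. (partial a (\<lambda>y. g y $ b $ d) x
      + partial b (\<lambda>y. g y $ a $ d) x
     - partial d (\<lambda>y. g y $ a $ b) x) / 2)"
  have "conn_matrix g a x = matrix_inv (g x) ** B"
    by (simp add: B_def conn_matrix_def christoffel_def matrix_matrix_mult_def sum_distrib_left
        vec_eq_iff)
  then have "g x ** conn_matrix g a x = B"
    by (simp add: matrix_mul_assoc matrix_inv_left_right invertible_g assms)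
  then show ?thesis by (simp add: B_def)
qed

text \<open>The equation \<open>\<nabla>g = 0\<close>, with \<open>g\<close> seen as a matrix: in the sum of the lowered Christoffel symbol and its
transpose only the derivative of \<open>g\<close> in direction \<open>a\<close> survives.\<close>

lemma metric_compatible:
  assumes "x \<in> S"
  shows "matrix_partial a g x = transpose (conn_matrix g a x) ** g x + g x ** conn_matrix g a x"
proof -
  have "transpose (conn_matrix g a x) ** g x = transpose (g x ** conn_matrix g a x)"
    by (simp add: matrix_transpose_mul symmetric_g assms)
  then have "(transpose (conn_matrix g a x) ** g x) $ b $ d = (g x ** conn_matrix g a x) $ d $ b"
      for b d
    by (simp add: transpose_def)
  then show ?thesis
    using partial_g_sym[OF assms]
    by (simp add: vec_eq_iff matrix_partial_def christoffel_lowered[OF assms] field_simps)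
qed

lemma torsion_free: "x \<in> S \<Longrightarrow> conn_matrix g a x $ c $ b = conn_matrix g b x $ c $ a"
  by (simp add: conn_matrix_def christoffel_def partial_g_sym[of x _ a b] add.commute)

text \<open>Used to identify the transform of the connection under a change of coordinates without computing with
the formula for the Christoffel symbols. Lowering the index of \<open>C\<close> turns compatibility and symmetry into
Koszul's linear system, whose only solution is the lowered Christoffel symbol.\<close>

lemma levi_civita_unique:
  assumes x: "x \<in> S" and sym: "\<And>a b c. C a $ c $ b = C b $ c $ a"
    and comp: "\<And>a. matrix_partial a g x = transpose (C a) ** g x + g x ** C a"
  shows "C a = conn_matrix g a x"
proof -
  define L where "L a = g x ** C a" for a
  have sym_L: "L a $ d $ b = L b $ d $ a" for a b d
    by (simp add: L_def matrix_matrix_mult_def sym[of a])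
  have "matrix_partial a g x = transpose (L a) + L a" for a
    using comp[of a] by (simp add: L_def matrix_transpose_mul symmetric_g x)
  then have dL: "partial a (\<lambda>y. g y $ b $ d) x = L a $ d $ b + L a $ b $ d" for a b d
    by (simp add: vec_eq_iff matrix_partial_def transpose_def)
  have "L a $ d $ b = (g x ** conn_matrix g a x) $ d $ b" for d b
    unfolding christoffel_lowered[OF x] dL
    using sym_L[of a d b] sym_L[of a b d] sym_L[of b a d] by simp
  then have "g x ** C a = g x ** conn_matrix g a x" by (simp add: L_def vec_eq_iff)
  then show ?thesis by (rule matrix_left_cancel[OF invertible_g[OF x]])
qed

lemmas diff_conn = smooth_matrix_on_differentiable[OF smooth_conn open_S]
lemmas diff_dconn = smooth_matrix_on_differentiable[OF smooth_matrix_on_partial[OF smooth_conn]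
    open_S]
lemmas diff_g = smooth_matrix_on_differentiable[OF smooth_g open_S]

text \<open>The skew-symmetry \<open>R\<^sub>a\<^sub>b\<^sub>c\<^sub>d = - R\<^sub>a\<^sub>b\<^sub>d\<^sub>c\<close>: it is the commutation of the second partial derivatives of \<open>g\<close>,
computed from metric compatibility.\<close>

lemma curv_metric_antisym:
  assumes x: "x \<in> S"
  shows "transpose (curv_matrix g a b x) ** g x + g x ** curv_matrix g a b x = 0"
proof -
  let ?G = "\<lambda>a. conn_matrix g a x" and ?D = "\<lambda>a b. matrix_partial a (conn_matrix g b) x"
  have *: "matrix_partial b (matrix_partial a g) x =
      transpose (?D b a) ** g x + transpose (?G a) ** (transpose (?G b) ** g x + g x ** ?G b)
      + ((transpose (?G b) ** g x + g x ** ?G b) ** ?G a + g x ** ?D b a)" for a b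
  proof -
    have "matrix_partial b (matrix_partial a g) x =
        matrix_partial b (\<lambda>y. transpose (conn_matrix g a y) ** g y + g y ** conn_matrix g a y) x"
      using open_S x metric_compatible by (rule matrix_partial_cong)
    then show ?thesis
      by (simp add: matrix_partial_add matrix_partial_mult matrix_differentiable_mult diff_g[OF x]
          diff_conn[OF x]
          matrix_differentiable_transpose matrix_partial_transpose metric_compatible[OF x])
  qed
  have "matrix_partial a (matrix_partial b g) x - matrix_partial b (matrix_partial a g) x = 0"
    using matrix_partial_commute[OF open_S smooth_g x] by simp
  then show ?thesis
    unfolding * curv_eq
    by (simp add: matrix_ring_simps transpose_add transpose_diff matrix_transpose_mul algebra_simps)
qed

text \<open>\<open>N\<close> differentiates the curvature matrix covariantly in its matrix indices only. The Christoffel terms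
for the two form indices cancel in the cyclic sum, so this is the full second Bianchi identity, and
it is the Jacobi identity for commutators together with the symmetry of second derivatives.\<close>

lemma second_bianchi:
  assumes x: "x \<in> S"
  defines "N \<equiv> \<lambda>e a b. matrix_partial e (curv_matrix g a b) x + conn_matrix g e x
      ** curv_matrix g a b x - curv_matrix g a b x ** conn_matrix g e x"
  shows "N e a b + N a b e + N b e a = 0"
proof -
  let ?G = "\<lambda>a. conn_matrix g a x" and ?D = "\<lambda>a b. matrix_partial a (conn_matrix g b) x"
  let ?DD = "\<lambda>a b c. matrix_partial a (matrix_partial b (conn_matrix g c)) x"
  have *: "matrix_partial e (curv_matrix g a b) x = ?DD e a b - ?DD e b a
      + (?D e a ** ?G b + ?G a ** ?D e b) - (?D e b ** ?G a + ?G b ** ?D e a)" for a b e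
    unfolding curv_eq[abs_def]
    by (simp add: matrix_partial_add matrix_partial_diff matrix_partial_mult
        matrix_differentiable_mult
        matrix_differentiable_add matrix_differentiable_diff diff_conn[OF x] diff_dconn[OF x])
  have c: "?DD a b c = ?DD b a c" for a b c
    using matrix_partial_commute[OF open_S smooth_conn x] .
  show ?thesis
    unfolding N_def * curv_eq using c[of e a b] c[of e b a] c[of a b e]
    by (simp add: matrix_ring_simps algebra_simps)
qed

text \<open>By the skew-symmetry, the curvature matrix is conjugate to minus its transpose.\<close>

lemma trace_curv:
  assumes x: "x \<in> S"
  shows "(\<Sum>c\<in>UNIV. curv_matrix g a b x $ c $ c) = 0"
proof -
  let ?R = "curv_matrix g a b x" and ?h = "matrix_inv (g x)"
  have h: "g x ** ?h = mat 1" "?h ** g x = mat 1" using matrix_inv_left_right invertible_g x by auto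
  have "trace ?R = trace (?h ** (g x ** ?R))" by (simp add: matrix_mul_assoc h)
  also have "g x ** ?R = - (transpose ?R ** g x)"
    using curv_metric_antisym[OF x, of a b] by (simp add: eq_neg_iff_add_eq_0 add.commute)
  also have "trace (?h ** - (transpose ?R ** g x)) = - trace (?h ** (transpose ?R ** g x))"
    by (simp add: trace_def matrix_matrix_mult_def sum_negf)
  also have "trace (?h ** (transpose ?R ** g x)) = trace ((transpose ?R ** g x) ** ?h)"
    by (rule trace_mul_sym)
  also have "\<dots> = trace (transpose ?R)"
    by (simp add: matrix_mul_assoc[symmetric] h)
  also have "\<dots> = trace ?R" by (simp add: trace_def transpose_def)
  finally show ?thesis by (simp add: trace_def)
qed

lemma curv_swap: "curv_matrix g a b x = - curv_matrix g b a x"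
  by (simp add: curv_eq)

lemma first_bianchi:
  assumes x: "x \<in> S"
  shows "curv_matrix g a b x $ c $ d + curv_matrix g b d x $ c $ a + curv_matrix g d a x $ c $ b
      = 0"
proof -
  have t: "conn_matrix g a x $ c $ b = conn_matrix g b x $ c $ a" for a b c
      using torsion_free[OF x] .
  have "matrix_partial a (conn_matrix g b) x $ c $ d = matrix_partial a (conn_matrix g d) x $ c $ b"
      for a b c d
    unfolding matrix_partial_def using open_S x torsion_free by (auto intro: partial_cong)
  note s = this[of a b c d] this[of b a c d] this[of d a c b]
  show ?thesis
    unfolding curv_eq
    by (simp add: s matrix_matrix_mult_def t[of b _ a] t[of d _ b] t[of d _ a])
qed

text \<open>Tracing the first Bianchi identity leaves the skew part of the Ricci tensor and the trace of the
curvature matrix, which vanishes.\<close>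

lemma ricci_matrix_sym:
  assumes x: "x \<in> S"
  shows "ricci_matrix g x $ a $ b = ricci_matrix g x $ b $ a"
proof -
  have "(\<Sum>c\<in>UNIV. curv_matrix g c a x $ c $ b + curv_matrix g a b x $ c $ c
      + curv_matrix g b c x $ c $ a) = 0"
    by (simp add: first_bianchi[OF x])
  then show ?thesis
    by (simp add: sum.distrib trace_curv[OF x] curv_swap[of b] sum_subtractf ricci_matrix_eq)
qed

end

section \<open>The contracted Bianchi identity\<close>

text \<open>The divergence \<open>\<nabla>\<^sub>aQ\<^sup>a\<^sub>e\<close> of a mixed tensor field. The last sum has \<open>\<Gamma>\<close> with its lower indices interchanged,
which brings it into the matrix form in which the curvature identities produce it.\<close>

definition mixed_divergence ::
    "(real^'n \<Rightarrow> real^'n^'n) \<Rightarrow> (real^'n \<Rightarrow> real^'n^'n) \<Rightarrow> 'n::finite \<Rightarrow> real^'n \<Rightarrow> real" where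
  "mixed_divergence g Q e x = (\<Sum>a\<in>UNIV. partial a (\<lambda>y. Q y $ a $ e) x)
     + (\<Sum>a\<in>UNIV. \<Sum>f\<in>UNIV. conn_matrix g a x $ a $ f * Q x $ f $ e)
     - (\<Sum>a\<in>UNIV. \<Sum>f\<in>UNIV. conn_matrix g e x $ a $ f * Q x $ f $ a)"

definition differential :: "(real^'n::finite \<Rightarrow> real) \<Rightarrow> real^'n \<Rightarrow> real^'n" where
  "differential f x = (\<chi> b. partial b f x)"

lemma sum_symmetric_antisymmetric:
  fixes F G :: "'n::finite \<Rightarrow> 'n \<Rightarrow> real"
  assumes "\<And>a b. F a b = F b a" "\<And>a b. G a b = - G b a"
  shows "(\<Sum>a\<in>UNIV. \<Sum>b\<in>UNIV. F a b * G a b) = 0"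
proof -
  have "(\<Sum>a\<in>UNIV. \<Sum>b\<in>UNIV. F a b * G a b) = (\<Sum>b\<in>UNIV. \<Sum>a\<in>UNIV. F a b * G a b)"
    by (rule sum.swap)
  also have "\<dots> = - (\<Sum>a\<in>UNIV. \<Sum>b\<in>UNIV. F a b * G a b)"
    unfolding sum_negf[symmetric]
    by (intro sum.cong refl) (metis assms mult_minus_right)
  finally show ?thesis by simp
qed

lemma sum_swap_inner:
  "(\<Sum>a\<in>A. \<Sum>b\<in>B. \<Sum>c\<in>C. f a b c) = (\<Sum>a\<in>A. \<Sum>c\<in>C. \<Sum>b\<in>B. f a b c)"
  by (rule sum.cong[OF refl sum.swap])

lemma sum_rotate:
  "(\<Sum>a\<in>A. \<Sum>b\<in>B. \<Sum>c\<in>C. f a b c) = (\<Sum>b\<in>B. \<Sum>c\<in>C. \<Sum>a\<in>A. f a b c)"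
  by (rule trans[OF sum.swap sum_swap_inner])

context metric_on begin

text \<open>The curvature \<open>R\<^sub>a\<^sub>b\<^sup>c\<^sup>d\<close> with its last index raised, which is skew in both pairs of indices. Contracting
these pairs with each other involves no metric.\<close>

definition curv_raised :: "'n \<Rightarrow> 'n \<Rightarrow> real^'n \<Rightarrow> real^'n^'n" where
  "curv_raised a b x = curv_matrix g a b x ** matrix_inv (g x)"

lemma smooth_curv_raised: "smooth_matrix_on S (curv_raised a b)"
  unfolding curv_raised_def[abs_def] by (intro smooth_matrix_on_mult open_S smooth_curv smooth_ginv)

lemma ginv: "x \<in> S \<Longrightarrow> g x ** matrix_inv (g x) = mat 1" "x \<in> S \<Longrightarrow> matrix_inv (g x) ** g x = mat 1"
  using matrix_inv_left_right invertible_g by auto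

lemma ginv_transpose: "x \<in> S \<Longrightarrow> transpose (matrix_inv (g x)) = matrix_inv (g x)"
  by (simp add: matrix_inv_symmetric invertible_g symmetric_g)

lemma ginv_sym: "x \<in> S \<Longrightarrow> matrix_inv (g x) $ a $ b = matrix_inv (g x) $ b $ a"
  using ginv_transpose[of x] by (simp add: transpose_def vec_eq_iff)

lemma curv_raised_swap: "curv_raised a b x = - curv_raised b a x"
  by (simp add: curv_raised_def curv_swap[of a b] matrix_matrix_mult_def vec_eq_iff sum_negf)

lemma curv_raised_antisym:
  assumes x: "x \<in> S"
  shows "curv_raised a b x $ c $ d = - curv_raised a b x $ d $ c"
proof -
  let ?h = "matrix_inv (g x)"
  have "?h ** (transpose (curv_matrix g a b x) ** g x + g x ** curv_matrix g a b x) ** ?h = 0"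
    unfolding curv_metric_antisym[OF x] by (simp add: matrix_matrix_mult_def vec_eq_iff)
  then have "?h ** transpose (curv_matrix g a b x) ** (g x ** ?h)
      + (?h ** g x) ** curv_matrix g a b x ** ?h = 0"
    by (simp only: matrix_ring_simps)
  then have "transpose (curv_raised a b x) + curv_raised a b x = 0"
    by (simp add: curv_raised_def matrix_transpose_mul ginv_transpose ginv x)
  then show ?thesis by (simp add: vec_eq_iff transpose_def eq_neg_iff_add_eq_0)
qed

lemma ricci_mixed_curv_raised:
  assumes x: "x \<in> S"
  shows "ricci_mixed g x $ a $ e = (\<Sum>b\<in>UNIV. curv_raised b e x $ b $ a)"
proof -
  have "(\<Sum>b\<in>UNIV. curv_raised b e x $ b $ a)
      = (\<Sum>b\<in>UNIV. \<Sum>d\<in>UNIV. curv_matrix g b e x $ b $ d * matrix_inv (g x) $ d $ a)"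
    by (simp add: curv_raised_def matrix_matrix_mult_def)
  also have "\<dots> = (\<Sum>d\<in>UNIV. ricci_matrix g x $ e $ d * matrix_inv (g x) $ d $ a)"
    by (subst sum.swap) (simp add: ricci_matrix_eq sum_distrib_right)
  also have "\<dots> = (\<Sum>d\<in>UNIV. matrix_inv (g x) $ a $ d * ricci_matrix g x $ d $ e)"
    by (simp add: ricci_matrix_sym[OF x, of e] ginv_sym[OF x, of a] mult.commute)
  finally show ?thesis by (simp add: ricci_mixed_eq matrix_matrix_mult_def)
qed

lemma scalar_curvature_trace:
  assumes x: "x \<in> S"
  shows "scalar_curvature g x = (\<Sum>a\<in>UNIV. ricci_mixed g x $ a $ a)"
  unfolding scalar_curvature_def ricci_mixed_def vec_lambda_beta
  using ricci_matrix_sym[OF x] by (simp add: ricci_matrix_def)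

lemma smooth_scalar_curvature: "smooth_on S (scalar_curvature g)"
proof -
  have "smooth_on S (\<lambda>x. \<Sum>a\<in>UNIV. ricci_mixed g x $ a $ a)"
    by (intro smooth_on_sum open_S smooth_matrix_onD smooth_ricci_mixed)
  then show ?thesis
    by (rule smooth_on_cong[OF open_S, THEN iffD1, rotated]) (simp add: scalar_curvature_trace)
qed

lemma partial_ginv:
  assumes x: "x \<in> S"
  shows "matrix_partial a (\<lambda>y. matrix_inv (g y)) x =
    - (conn_matrix g a x ** matrix_inv (g x) + matrix_inv (g x) ** transpose (conn_matrix g a x))"
proof -
  let ?h = "matrix_inv (g x)" and ?dh = "matrix_partial a (\<lambda>y. matrix_inv (g y)) x"
      and ?G = "conn_matrix g a x"
  have "matrix_partial a (\<lambda>y. matrix_inv (g y) ** g y) x = matrix_partial a (\<lambda>y. mat 1) x"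
    using open_S x ginv(2) by (rule matrix_partial_cong)
  then have "?dh ** g x + ?h ** (transpose ?G ** g x + g x ** ?G) = 0"
    by (simp add: matrix_partial_const matrix_partial_mult diff_g[OF x] metric_compatible[OF x]
        smooth_matrix_on_differentiable[OF smooth_ginv open_S x])
  then have "(?dh ** g x + ?h ** (transpose ?G ** g x + g x ** ?G)) ** ?h = 0"
    by (simp add: matrix_matrix_mult_def vec_eq_iff)
  then have "?dh ** (g x ** ?h) + (?h ** transpose ?G ** (g x ** ?h) + (?h ** g x) ** ?G ** ?h) = 0"
    by (simp only: matrix_ring_simps)
  then show ?thesis by (simp add: ginv x eq_neg_iff_add_eq_0 add_ac del: minus_add_distrib)
qed

text \<open>The metric is parallel, so raising an index commutes with covariant differentiation.\<close>

lemma second_bianchi_raised: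
  assumes x: "x \<in> S"
  defines "N \<equiv> \<lambda>e a b. matrix_partial e (curv_raised a b) x + conn_matrix g e x ** curv_raised a b x
      + curv_raised a b x ** transpose (conn_matrix g e x)"
  shows "N e a b + N a b e + N b e a = 0"
proof -
  let ?h = "matrix_inv (g x)"
  let ?N = "\<lambda>e a b. matrix_partial e (curv_matrix g a b) x + conn_matrix g e x
      ** curv_matrix g a b x - curv_matrix g a b x ** conn_matrix g e x"
  have neg: "A ** - B = - (A ** B)" for A B :: "real^'n^'n"
    by (simp add: matrix_matrix_mult_def vec_eq_iff sum_negf)
  have N: "N e a b = ?N e a b ** ?h" for e a b
    unfolding N_def curv_raised_def[abs_def]
    by (simp add: matrix_partial_mult partial_ginv[OF x]
        smooth_matrix_on_differentiable[OF smooth_curv open_S x]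
        smooth_matrix_on_differentiable[OF smooth_ginv open_S x] matrix_ring_simps neg)
  have "N e a b + N a b e + N b e a = (?N e a b + ?N a b e + ?N b e a) ** ?h"
    unfolding N by (simp only: matrix_add_rdistrib)
  also have "\<dots> = 0"
    unfolding second_bianchi[OF x] by (simp add: matrix_matrix_mult_def vec_eq_iff)
  finally show ?thesis .
qed

text \<open>Contracting both pairs of indices in the raised second Bianchi identity: one of the three cyclic terms
gives the derivative of \<open>R\<close>, and the other two each give minus the divergence of the Ricci tensor.\<close>

lemma contracted_bianchi:
  assumes x: "x \<in> S"
  shows "partial e (scalar_curvature g) x = 2 * mixed_divergence g (ricci_mixed g) e x"
proof -
  let ?P = "ricci_mixed g" and ?G = "\<lambda>a. conn_matrix g a x"
  define N where "N e a b = matrix_partial e (curv_raised a b) x + conn_matrix g e x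
      ** curv_raised a b x + curv_raised a b x ** transpose (conn_matrix g e x)" for e a b
  have d_raised: "(\<lambda>y. curv_raised a b y $ c $ d) differentiable (at x)" for a b c d
    using smooth_on_differentiable[OF smooth_matrix_onD[OF smooth_curv_raised] open_S x] .
  have P1: "(\<Sum>b\<in>UNIV. curv_raised b e y $ b $ a) = ?P y $ a $ e" if "y \<in> S" for y a e
    by (simp add: ricci_mixed_curv_raised that)
  have P2: "(\<Sum>b\<in>UNIV. curv_raised b e y $ a $ b) = - ?P y $ a $ e" if "y \<in> S" for y a e
    unfolding P1[OF that, symmetric] sum_negf[symmetric] using curv_raised_antisym[OF that]
        by (intro sum.cong refl)
  have P3: "(\<Sum>b\<in>UNIV. curv_raised e b y $ a $ b) = ?P y $ a $ e" if "y \<in> S" for y a e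
    unfolding P1[OF that, symmetric]
    by (intro sum.cong refl) (metis curv_raised_antisym[OF that] curv_raised_swap minus_minus
        vector_uminus_component)
  have P4: "(\<Sum>b\<in>UNIV. curv_raised e b y $ b $ a) = - ?P y $ a $ e" if "y \<in> S" for y a e
    unfolding P1[OF that, symmetric] sum_negf[symmetric]
    by (intro sum.cong refl) (metis curv_raised_swap vector_uminus_component)
  have dP1: "(\<Sum>b\<in>UNIV. partial k (\<lambda>y. curv_raised b e y $ b $ a) x)
      = partial k (\<lambda>y. ?P y $ a $ e) x" for a e k
  proof -
    have "(\<Sum>b\<in>UNIV. partial k (\<lambda>y. curv_raised b e y $ b $ a) x)
        = partial k (\<lambda>y. \<Sum>b\<in>UNIV. curv_raised b e y $ b $ a) x"
      by (simp add: partial_sum d_raised)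
    also have "\<dots> = partial k (\<lambda>y. ?P y $ a $ e) x"
      using open_S x by (rule partial_cong) (rule P1)
    finally show ?thesis .
  qed
  have dP2: "(\<Sum>b\<in>UNIV. partial k (\<lambda>y. curv_raised b e y $ a $ b) x)
      = - partial k (\<lambda>y. ?P y $ a $ e) x" for a e k
  proof -
    have "partial k (\<lambda>y. curv_raised b e y $ a $ b) x = partial k (\<lambda>y.
        - 1 * curv_raised b e y $ b $ a) x" for b
      by (intro partial_cong[OF open_S x]) (metis curv_raised_antisym mult_minus1)
    then show ?thesis by (simp only: partial_cmult[OF d_raised]) (simp add: sum_negf dP1)
  qed
  have dP4: "(\<Sum>b\<in>UNIV. partial k (\<lambda>y. curv_raised e b y $ b $ a) x)
      = - partial k (\<lambda>y. ?P y $ a $ e) x" for a e k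
  proof -
    have "partial k (\<lambda>y. curv_raised e b y $ b $ a) x = partial k (\<lambda>y.
        - 1 * curv_raised b e y $ b $ a) x" for b
      by (intro partial_cong[OF open_S x]) (metis curv_raised_swap vector_uminus_component
          mult_minus1)
    then show ?thesis by (simp only: partial_cmult[OF d_raised]) (simp add: sum_negf dP1)
  qed
  have "partial e (scalar_curvature g) x = partial e (\<lambda>y. \<Sum>a\<in>UNIV. ?P y $ a $ a) x"
    by (rule partial_cong[OF open_S x scalar_curvature_trace])
  then have dR: "partial e (scalar_curvature g) x = (\<Sum>a\<in>UNIV. partial e (\<lambda>y. ?P y $ a $ a) x)"
    using smooth_on_differentiable[OF smooth_matrix_onD[OF smooth_ricci_mixed] open_S x]
        by (simp add: partial_sum)
  \<comment> \<open>Where both lower indices of \<open>\<Gamma>\<close> meet the raised pair, a symmetric factor meets a skew one.\<close>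
  have torsion_curv: "(\<Sum>a\<in>UNIV. \<Sum>f\<in>UNIV. ?G a $ b $ f * curv_raised c d x $ a $ f) = 0" for b c d
    by (intro sum_symmetric_antisymmetric torsion_free curv_raised_antisym x)
  have torsion_curv': "(\<Sum>a\<in>UNIV. \<Sum>f\<in>UNIV. ?G a $ b $ f * curv_raised c d x $ f $ a) = 0" for b c d
    by (intro sum_symmetric_antisymmetric torsion_free curv_raised_antisym x)
  have "(\<Sum>a\<in>UNIV. \<Sum>b\<in>UNIV. N e a b $ a $ b) =
      (\<Sum>b\<in>UNIV. \<Sum>a\<in>UNIV. partial e (\<lambda>y. curv_raised a b y $ a $ b) x)
    + (\<Sum>a\<in>UNIV. \<Sum>f\<in>UNIV. \<Sum>b\<in>UNIV. ?G e $ a $ f * curv_raised a b x $ f $ b)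
    + (\<Sum>b\<in>UNIV. \<Sum>f\<in>UNIV. \<Sum>a\<in>UNIV. ?G e $ b $ f * curv_raised a b x $ a $ f)"
    unfolding N_def vector_add_component matrix_partial_def matrix_matrix_mult_def transpose_def
        vec_lambda_beta sum.distrib
    using sum.swap[of "\<lambda>a b. partial e (\<lambda>y. curv_raised a b y $ a $ b) x" UNIV UNIV]
      sum_swap_inner[of "\<lambda>a b f. ?G e $ a $ f * curv_raised a b x $ f $ b" UNIV UNIV UNIV]
      sum_rotate[of "\<lambda>a b f. ?G e $ b $ f * curv_raised a b x $ a $ f" UNIV UNIV UNIV]
    by (simp add: mult.commute)
  also have "\<dots> = partial e (scalar_curvature g) x
      + 2 * (\<Sum>a\<in>UNIV. \<Sum>f\<in>UNIV. ?G e $ a $ f * ?P x $ f $ a)"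
    by (simp add: dP1 dR sum_distrib_left[symmetric] P1[OF x] P3[OF x])
  finally have T1: "(\<Sum>a\<in>UNIV. \<Sum>b\<in>UNIV. N e a b $ a $ b) = \<dots>" .
  have "(\<Sum>a\<in>UNIV. \<Sum>b\<in>UNIV. N a b e $ a $ b) =
      (\<Sum>a\<in>UNIV. \<Sum>b\<in>UNIV. partial a (\<lambda>y. curv_raised b e y $ a $ b) x)
    + (\<Sum>a\<in>UNIV. \<Sum>f\<in>UNIV. \<Sum>b\<in>UNIV. ?G a $ a $ f * curv_raised b e x $ f $ b)
    + (\<Sum>b\<in>UNIV. \<Sum>a\<in>UNIV. \<Sum>f\<in>UNIV. ?G a $ b $ f * curv_raised b e x $ a $ f)"
    unfolding N_def vector_add_component matrix_partial_def matrix_matrix_mult_def transpose_def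
        vec_lambda_beta sum.distrib
    using sum_swap_inner[of "\<lambda>a b f. ?G a $ a $ f * curv_raised b e x $ f $ b" UNIV UNIV UNIV]
      sum.swap[of "\<lambda>a b. \<Sum>f\<in>UNIV. ?G a $ b $ f * curv_raised b e x $ a $ f" UNIV UNIV]
    by (simp add: mult.commute)
  also have "\<dots> = - (\<Sum>a\<in>UNIV. partial a (\<lambda>y. ?P y $ a $ e) x)
      - (\<Sum>a\<in>UNIV. \<Sum>f\<in>UNIV. ?G a $ a $ f * ?P x $ f $ e)"
    by (simp add: dP2 sum_distrib_left[symmetric] P2[OF x] torsion_curv sum_negf)
  finally have T2: "(\<Sum>a\<in>UNIV. \<Sum>b\<in>UNIV. N a b e $ a $ b) = \<dots>" .
  have "(\<Sum>a\<in>UNIV. \<Sum>b\<in>UNIV. N b e a $ a $ b) =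
      (\<Sum>b\<in>UNIV. \<Sum>a\<in>UNIV. partial b (\<lambda>y. curv_raised e a y $ a $ b) x)
    + (\<Sum>a\<in>UNIV. \<Sum>b\<in>UNIV. \<Sum>f\<in>UNIV. ?G b $ a $ f * curv_raised e a x $ f $ b)
    + (\<Sum>b\<in>UNIV. \<Sum>f\<in>UNIV. \<Sum>a\<in>UNIV. ?G b $ b $ f * curv_raised e a x $ a $ f)"
    unfolding N_def vector_add_component matrix_partial_def matrix_matrix_mult_def transpose_def
        vec_lambda_beta sum.distrib
    using sum.swap[of "\<lambda>a b. partial b (\<lambda>y. curv_raised e a y $ a $ b) x" UNIV UNIV]
      sum_rotate[of "\<lambda>a b f. ?G b $ b $ f * curv_raised e a x $ a $ f" UNIV UNIV UNIV]
    by (simp add: mult.commute)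
  also have "\<dots> = - (\<Sum>a\<in>UNIV. partial a (\<lambda>y. ?P y $ a $ e) x)
      - (\<Sum>a\<in>UNIV. \<Sum>f\<in>UNIV. ?G a $ a $ f * ?P x $ f $ e)"
    by (simp add: dP4 sum_distrib_left[symmetric] P4[OF x] torsion_curv' sum_negf)
  finally have T3: "(\<Sum>a\<in>UNIV. \<Sum>b\<in>UNIV. N b e a $ a $ b) = \<dots>" .
  have "N e a b $ a $ b + N a b e $ a $ b + N b e a $ a $ b = 0" for a b
    using second_bianchi_raised[OF x, of e a b] by (simp add: N_def vec_eq_iff)
  then have "(\<Sum>a\<in>UNIV. \<Sum>b\<in>UNIV. N e a b $ a $ b + N a b e $ a $ b + N b e a $ a $ b) = 0" by simp
  then show ?thesis
    unfolding mixed_divergence_def sum.distrib T1 T2 T3 by (simp add: algebra_simps)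
qed

section \<open>The linear equation for a gradient soliton\<close>

lemma mixed_divergence_add:
  assumes "\<And>a. (\<lambda>y. P y $ a $ e) differentiable (at x)"
      "\<And>a. (\<lambda>y. Q y $ a $ e) differentiable (at x)"
  shows "mixed_divergence g (\<lambda>y. P y + Q y) e x = mixed_divergence g P e x
      + mixed_divergence g Q e x"
  by (simp add: mixed_divergence_def partial_add assms sum.distrib distrib_left)

lemma mixed_divergence_scaleR:
  assumes "\<And>a. (\<lambda>y. Q y $ a $ e) differentiable (at x)"
  shows "mixed_divergence g (\<lambda>y. r *\<^sub>R Q y) e x = r * mixed_divergence g Q e x"
  by (simp add: mixed_divergence_def partial_cmult assms sum_distrib_left right_diff_distrib
      distrib_left mult.left_commute)

lemma mixed_divergence_mat:
  assumes x: "x \<in> S"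
  shows "mixed_divergence g (\<lambda>y. mat r) e x = 0"
proof -
  have "(\<Sum>a\<in>UNIV. \<Sum>f\<in>UNIV. conn_matrix g a x $ a $ f * (mat r :: real^'n^'n) $ f $ e)
      = (\<Sum>a\<in>UNIV. conn_matrix g a x $ a $ e * r)"
    by (simp add: mat_def if_distrib[of "\<lambda>z. _ * z"] cong: if_cong)
  moreover have "(\<Sum>a\<in>UNIV. \<Sum>f\<in>UNIV. conn_matrix g e x $ a $ f * (mat r :: real^'n^'n) $ f $ a)
      = (\<Sum>a\<in>UNIV. conn_matrix g e x $ a $ a * r)"
    by (simp add: mat_def if_distrib[of "\<lambda>z. _ * z"] cong: if_cong)
  ultimately show ?thesis
    by (simp add: mixed_divergence_def torsion_free[OF x, of e])
qed

text \<open>Here \<open>Q\<^sup>a\<^sub>b = \<nabla>\<^sub>bV\<^sup>a\<close>, and the contraction of \<open>\<nabla>\<^sub>a\<nabla>\<^sub>bV\<^sup>a - \<nabla>\<^sub>b\<nabla>\<^sub>aV\<^sup>a\<close> is a Ricci term.\<close>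

lemma ricci_identity_contracted:
  fixes V :: "real^'n \<Rightarrow> real^'n" and Q :: "real^'n \<Rightarrow> real^'n^'n"
  assumes V: "\<And>a. smooth_on S (\<lambda>y. V y $ a)"
    and Q: "\<And>y a b. y \<in> S \<Longrightarrow> Q y $ a $ b = partial b (\<lambda>y. V y $ a) y
        + (conn_matrix g b y *v V y) $ a"
    and x: "x \<in> S"
  shows "mixed_divergence g Q b x - partial b (\<lambda>y. \<Sum>a\<in>UNIV. Q y $ a $ a) x
      = (\<Sum>d\<in>UNIV. ricci_matrix g x $ b $ d * V x $ d)"
proof -
  \<comment> \<open>Vectors become matrices with equal columns, so that the matrix calculus applies to them.\<close>
  define W where "W = (\<lambda>y. \<chi> c k::'n. V y $ c)"
  define T where "T b y = (\<chi> c k::'n. Q y $ c $ b)" for b y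
  have sW: "smooth_matrix_on S W" using V by (simp add: W_def smooth_matrix_on_def)
  note dW = smooth_matrix_on_differentiable[OF sW open_S x]
  note ddW = smooth_matrix_on_differentiable[OF smooth_matrix_on_partial[OF sW] open_S x]
  have T: "T b y = matrix_partial b W y + conn_matrix g b y ** W y" if "y \<in> S" for b y
    by (simp add: T_def W_def Q[OF that] matrix_partial_def matrix_matrix_mult_def
        matrix_vector_mult_def vec_eq_iff)
  have dT: "matrix_partial a (T b) x = matrix_partial a (matrix_partial b W) x
      + (matrix_partial a (conn_matrix g b) x ** W x + conn_matrix g b x ** matrix_partial a W x)"
          for a b
  proof -
    have "matrix_partial a (T b) x = matrix_partial a (\<lambda>y. matrix_partial b W y + conn_matrix g b y
        ** W y) x"
      using open_S x T by (rule matrix_partial_cong)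
    then show ?thesis
      by (simp add: matrix_partial_add matrix_partial_mult matrix_differentiable_mult ddW dW
          diff_conn[OF x])
  qed
  have ri: "(matrix_partial a (T b) x + conn_matrix g a x ** T b x) - (matrix_partial b (T a) x
      + conn_matrix g b x ** T a x) = curv_matrix g a b x ** W x" for a
    unfolding dT T[OF x] curv_eq using matrix_partial_commute[OF open_S sW x, of a b]
    by (simp add: matrix_ring_simps algebra_simps)
  have dQ: "(\<lambda>y. Q y $ c $ b) differentiable (at x)" for c b
  proof -
    have "smooth_matrix_on S (\<lambda>y. matrix_partial b W y + conn_matrix g b y ** W y)"
      by (intro smooth_matrix_on_add smooth_matrix_on_mult smooth_matrix_on_partial sW smooth_conn
          open_S)
    then have "smooth_on S (\<lambda>y. (matrix_partial b W y + conn_matrix g b y ** W y) $ c $ b)"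
        by (rule smooth_matrix_onD)
    then have "smooth_on S (\<lambda>y. Q y $ c $ b)"
      by (rule smooth_on_cong[OF open_S, THEN iffD1, rotated]) (simp add: T[symmetric] T_def)
    then show ?thesis using open_S x smooth_on_differentiable by blast
  qed
  have "(\<Sum>a\<in>UNIV. ((matrix_partial a (T b) x + conn_matrix g a x ** T b x)
      - (matrix_partial b (T a) x + conn_matrix g b x ** T a x)) $ a $ b)
     = (\<Sum>a\<in>UNIV. (curv_matrix g a b x ** W x) $ a $ b)"
    unfolding ri ..
  moreover have "(\<Sum>a\<in>UNIV. (curv_matrix g a b x ** W x) $ a $ b)
      = (\<Sum>d\<in>UNIV. ricci_matrix g x $ b $ d * V x $ d)"
    by (simp add: matrix_matrix_mult_def W_def ricci_matrix_eq sum_distrib_right) (rule sum.swap)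
  ultimately show ?thesis
    by (simp add: mixed_divergence_def T_def matrix_partial_def matrix_matrix_mult_def sum_subtractf
        sum.distrib partial_sum dQ)
qed

text \<open>The contracted Ricci identity for the vector field \<open>V\<close> dual to \<open>u\<close>, with all derivatives of \<open>u\<close>
eliminated by means of the soliton equation. Write \<open>N = u\<^sub>aV\<^sup>a\<close>, \<open>w\<^sub>b = R\<^sub>b\<^sub>dV\<^sup>d\<close> and
\<open>s\<^sub>b = V\<^sup>a\<nabla>\<^sub>bu\<^sub>a = - c\<^sub>1Nu\<^sub>b + c\<^sub>2w\<^sub>b + \<lambda>u\<^sub>b\<close>, and \<open>Q\<close> for the right-hand side of the soliton equation with an index
raised. Then \<open>div(V \<otimes> u)\<^sub>b = u\<^sub>b tr(Q) + s\<^sub>b\<close> and \<open>\<partial>\<^sub>bN = 2s\<^sub>b\<close>, and the terms with \<open>N\<close> cancel.\<close>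

lemma soliton_linear_equation:
  fixes u :: "real^'n \<Rightarrow> real^'n"
  assumes u: "\<And>a. smooth_on S (\<lambda>y. u y $ a)"
    and eq: "\<And>y a b. y \<in> S \<Longrightarrow>
      cov_deriv g u a b y = - c1 * u y $ a * u y $ b + c2 * ricci g a b y + lam * g y $ a $ b"
    and x: "x \<in> S"
  shows "transpose (rho c1 c2 lam g x) *v u x = - (c2 / 2) *\<^sub>R differential (scalar_curvature g) x"
proof -
  define V where "V y = matrix_inv (g y) *v u y" for y
  define VU where "VU y = (\<chi> a b. V y $ a * u y $ b)" for y
  define Q where "Q y = (- c1) *\<^sub>R VU y + (c2 *\<^sub>R ricci_mixed g y + mat lam)" for y
  define Z where "Z b y = (\<chi> d k::'n. cov_deriv g u b d y)" for b y
  define U where "U y = (\<chi> d k::'n. u y $ d)" for y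
  have sU: "smooth_matrix_on S U" using u by (simp add: U_def smooth_matrix_on_def)
  have V: "smooth_on S (\<lambda>y. V y $ a)" for a
    unfolding V_def matrix_vector_mult_def vec_lambda_beta
    by (intro smooth_on_sum smooth_on_mult open_S smooth_matrix_onD[OF smooth_ginv] u)
  have dV: "(\<lambda>y. V y $ a) differentiable (at y)" if "y \<in> S" for a y
    using smooth_on_differentiable[OF V open_S that] .
  have du: "(\<lambda>y. u y $ a) differentiable (at y)" if "y \<in> S" for a y
    using smooth_on_differentiable[OF u open_S that] .
  have dP: "(\<lambda>y. ricci_mixed g y $ a $ b) differentiable (at x)" for a b
    using smooth_on_differentiable[OF smooth_matrix_onD[OF smooth_ricci_mixed] open_S x] .
  have cov: "cov_deriv g u a b y = partial a (\<lambda>y. u y $ b) y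
      - (\<Sum>c\<in>UNIV. conn_matrix g a y $ c $ b * u y $ c)" for a b y
    by (simp add: cov_deriv_def conn_matrix_def)
  have Vc: "V y = column k (matrix_inv (g y) ** U y)" for y k
    by (simp add: V_def U_def column_def matrix_matrix_mult_def matrix_vector_mult_def)
  have DV: "partial b (\<lambda>y. V y $ a) y + (conn_matrix g b y *v V y) $ a
      = (matrix_inv (g y) ** Z b y) $ a $ k" if y: "y \<in> S" for a b k y
  proof -
    have "(\<lambda>y. V y $ a) = (\<lambda>y. (matrix_inv (g y) ** U y) $ a $ k)"
      by (simp add: Vc[of _ k] column_def)
    then have "partial b (\<lambda>y. V y $ a) y = matrix_partial b (\<lambda>y. matrix_inv (g y) ** U y) y $ a $ k"
      by (simp add: matrix_partial_def)
    also have "matrix_partial b (\<lambda>y. matrix_inv (g y) ** U y) y =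
       - (conn_matrix g b y ** matrix_inv (g y) + matrix_inv (g y) ** transpose (conn_matrix g b y))
       ** U y + matrix_inv (g y) ** matrix_partial b U y"
      by (simp add: matrix_partial_mult smooth_matrix_on_differentiable[OF smooth_ginv open_S y]
          smooth_matrix_on_differentiable[OF sU open_S y] partial_ginv y)
    finally have 1: "partial b (\<lambda>y. V y $ a) y = \<dots> $ a $ k" .
    have 2: "(conn_matrix g b y *v V y) $ a = (conn_matrix g b y ** (matrix_inv (g y)
        ** U y)) $ a $ k"
      by (simp add: Vc[of _ k] column_def matrix_vector_mult_def matrix_matrix_mult_def)
    have neg: "- A ** B = - (A ** B)" for A B :: "real^'n^'n"
      by (simp add: matrix_matrix_mult_def vec_eq_iff sum_negf)
    have 3: "Z b y = matrix_partial b U y - transpose (conn_matrix g b y) ** U y"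
      by (simp add: Z_def U_def cov matrix_partial_def transpose_def matrix_matrix_mult_def
          vec_eq_iff)
    show ?thesis
      unfolding 1 2 3 by (simp add: matrix_ring_simps neg)
  qed
  have Q: "Q y $ a $ b = partial b (\<lambda>y. V y $ a) y + (conn_matrix g b y *v V y) $ a" if y: "y \<in> S"
      for y a b
  proof -
    have "(\<Sum>d\<in>UNIV. matrix_inv (g y) $ a $ d * ricci g b d y) = ricci_mixed g y $ a $ b"
      using ricci_matrix_sym[OF y] by (simp add: ricci_mixed_def ricci_matrix_def)
    moreover have "(\<Sum>d\<in>UNIV. matrix_inv (g y) $ a $ d * g y $ b $ d)
        = (mat 1 :: real^'n^'n) $ a $ b"
      unfolding ginv(2)[OF y, symmetric] by (simp add: matrix_matrix_mult_def g_sym[OF y, of b])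
    moreover have "(\<Sum>d\<in>UNIV. matrix_inv (g y) $ a $ d * cov_deriv g u b d y)
      = (\<Sum>d\<in>UNIV. - c1 * u y $ b * (matrix_inv (g y) $ a $ d * u y $ d)
          + c2 * (matrix_inv (g y) $ a $ d * ricci g b d y)
          + lam * (matrix_inv (g y) $ a $ d * g y $ b $ d))"
      by (intro sum.cong refl) (simp add: eq[OF y] algebra_simps)
    ultimately have "(\<Sum>d\<in>UNIV. matrix_inv (g y) $ a $ d * cov_deriv g u b d y)
      = - c1 * u y $ b * V y $ a + c2 * ricci_mixed g y $ a $ b
          + lam * (mat 1 :: real^'n^'n) $ a $ b"
      unfolding sum.distrib by (simp only: sum_distrib_left[symmetric]) (simp add: V_def
          matrix_vector_mult_def)
    then show ?thesis
      unfolding DV[OF y, of b a b]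
      by (simp add: Q_def VU_def matrix_matrix_mult_def Z_def mat_def mult_ac)
  qed
  define N where "N = (\<Sum>a\<in>UNIV. V x $ a * u x $ a)"
  define w where "w b = (\<Sum>d\<in>UNIV. ricci_matrix g x $ b $ d * V x $ d)" for b
  define s where "s b = (\<Sum>a\<in>UNIV. V x $ a * cov_deriv g u b a x)" for b
  have s: "s b = - c1 * u x $ b * N + c2 * w b + lam * u x $ b" for b
  proof -
    have "(\<Sum>a\<in>UNIV. g x $ b $ a * V x $ a) = (g x *v V x) $ b" by (simp add: matrix_vector_mult_def)
    also have "\<dots> = u x $ b" by (simp add: V_def matrix_vector_mul_assoc ginv x)
    finally have "(\<Sum>a\<in>UNIV. g x $ b $ a * V x $ a) = u x $ b" .
    moreover have "s b = (\<Sum>a\<in>UNIV. - c1 * u x $ b * (V x $ a * u x $ a)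
        + c2 * (ricci_matrix g x $ b $ a * V x $ a)
          + lam * (g x $ b $ a * V x $ a))"
      unfolding s_def by (intro sum.cong refl) (simp add: eq[OF x] ricci_matrix_def algebra_simps)
    ultimately show ?thesis
      unfolding sum.distrib by (simp only: sum_distrib_left[symmetric] w_def[symmetric]
          N_def[symmetric])
  qed
  have sdiff: "(\<Sum>a\<in>UNIV. V x $ a * cov_deriv g u a b x) = s b" for b
    unfolding s_def eq[OF x] using ricci_matrix_sym[OF x] g_sym[OF x]
        by (simp add: ricci_matrix_def mult_ac)
  have divVU: "mixed_divergence g VU b x = u x $ b * (\<Sum>a\<in>UNIV. Q x $ a $ a) + s b" for b
  proof -
    have "(\<Sum>a\<in>UNIV. \<Sum>f\<in>UNIV. conn_matrix g b x $ a $ f * (V x $ f * u x $ a))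
      = (\<Sum>a\<in>UNIV. V x $ a * (\<Sum>c\<in>UNIV. conn_matrix g a x $ c $ b * u x $ c))"
      by (subst sum.swap) (simp add: sum_distrib_left torsion_free[OF x, of b] mult_ac)
    then show ?thesis
      unfolding sdiff[symmetric] cov
      by (simp add: mixed_divergence_def VU_def partial_mult dV du x Q[OF x] matrix_vector_mult_def
          sum.distrib
          sum_subtractf right_diff_distrib distrib_left sum_distrib_left mult_ac)
  qed
  have gradN: "partial b (\<lambda>y. \<Sum>a\<in>UNIV. V y $ a * u y $ a) x = 2 * s b" for b
  proof -
    have "partial b (\<lambda>y. \<Sum>a\<in>UNIV. V y $ a * u y $ a) x
      = (\<Sum>a\<in>UNIV. partial b (\<lambda>y. V y $ a) x * u x $ a)
          + (\<Sum>a\<in>UNIV. V x $ a * partial b (\<lambda>y. u y $ a) x)"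
      by (simp add: partial_sum partial_mult dV du x sum.distrib)
    also have "(\<Sum>a\<in>UNIV. V x $ a * partial b (\<lambda>y. u y $ a) x)
        = s b + (\<Sum>a\<in>UNIV. \<Sum>c\<in>UNIV. V x $ a * (conn_matrix g b x $ c $ a * u x $ c))"
      by (simp add: s_def cov right_diff_distrib sum_subtractf sum_distrib_left)
    also have "(\<Sum>a\<in>UNIV. \<Sum>c\<in>UNIV. V x $ a * (conn_matrix g b x $ c $ a * u x $ c))
        = (\<Sum>a\<in>UNIV. (conn_matrix g b x *v V x) $ a * u x $ a)"
      by (subst sum.swap) (simp add: matrix_vector_mult_def sum_distrib_left mult_ac)
    also have "(\<Sum>a\<in>UNIV. partial b (\<lambda>y. V y $ a) x * u x $ a) =
        (\<Sum>a\<in>UNIV. (matrix_inv (g x) ** Z b x) $ a $ b * u x $ a)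
        - (\<Sum>a\<in>UNIV. (conn_matrix g b x *v V x) $ a * u x $ a)"
      unfolding DV[OF x, symmetric] by (simp add: algebra_simps sum.distrib)
    also have "(\<Sum>a\<in>UNIV. (matrix_inv (g x) ** Z b x) $ a $ b * u x $ a) =
        (\<Sum>a\<in>UNIV. \<Sum>d\<in>UNIV. matrix_inv (g x) $ d $ a * u x $ a * cov_deriv g u b d x)"
      by (simp add: matrix_matrix_mult_def Z_def sum_distrib_left ginv_sym[OF x] mult_ac)
    also have "\<dots> = s b"
      by (subst sum.swap) (simp add: s_def V_def matrix_vector_mult_def sum_distrib_right)
    finally show ?thesis by simp
  qed
  have trQ: "(\<Sum>a\<in>UNIV. Q y $ a $ a) = - c1 * (\<Sum>a\<in>UNIV. V y $ a * u y $ a)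
      + (c2 * scalar_curvature g y + CARD('n) * lam)" if "y \<in> S" for y
    by (simp add: Q_def VU_def sum.distrib sum_negf sum_subtractf sum_distrib_left
        scalar_curvature_trace that mat_def)
  have dtrQ: "partial b (\<lambda>y. \<Sum>a\<in>UNIV. Q y $ a $ a) x = - c1 * (2 * s b)
      + c2 * partial b (scalar_curvature g) x" for b
  proof -
    have dR: "scalar_curvature g differentiable (at x)"
      using smooth_on_differentiable[OF smooth_scalar_curvature open_S x] .
    have dN: "(\<lambda>y. \<Sum>a\<in>UNIV. V y $ a * u y $ a) differentiable (at x)"
      using dV du x by simp
    have "partial b (\<lambda>y. \<Sum>a\<in>UNIV. Q y $ a $ a) x =
      partial b (\<lambda>y. - c1 * (\<Sum>a\<in>UNIV. V y $ a * u y $ a) + (c2 * scalar_curvature g y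
          + CARD('n) * lam)) x"
      using open_S x trQ by (rule partial_cong)
    also have "\<dots> = - c1 * (2 * s b) + c2 * partial b (scalar_curvature g) x"
      using dN dR by (subst partial_add partial_cmult, simp, simp)+ (simp add: gradN)
    finally show ?thesis .
  qed
  have divQ: "mixed_divergence g Q b x = - c1 * mixed_divergence g VU b x
      + c2 * mixed_divergence g (ricci_mixed g) b x" for b
  proof -
    have dVU: "(\<lambda>y. VU y $ a $ b) differentiable (at x)" for a
      using dV du x by (simp add: VU_def)
    have "mixed_divergence g Q b x = mixed_divergence g (\<lambda>y. (- c1) *\<^sub>R VU y) b x
      + (mixed_divergence g (\<lambda>y. c2 *\<^sub>R ricci_mixed g y) b x
          + mixed_divergence g (\<lambda>y. mat lam) b x)"
      unfolding Q_def[abs_def] using dVU dP by (subst mixed_divergence_add, simp, simp)+ simp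
    then show ?thesis
      by (simp only: mixed_divergence_scaleR[of VU, OF dVU]
          mixed_divergence_scaleR[of "ricci_mixed g", OF dP] mixed_divergence_mat[OF x] add_0_right)
  qed
  have main: "(1 - c1 * c2) * w b + c1 * (c2 * scalar_curvature g x + (real CARD('n)
      - 1) * lam) * u x $ b
     = - (c2 / 2) * partial b (scalar_curvature g) x" for b
    using ricci_identity_contracted[OF V Q x, of b, folded w_def] contracted_bianchi[OF x, of b]
        s[of b] trQ[OF x]
    unfolding divQ dtrQ divVU N_def[symmetric] by (simp add: algebra_simps)
  have Pu: "(\<Sum>c\<in>UNIV. ricci_mixed g x $ c $ b * u x $ c) = w b" for b
  proof -
    have "(\<Sum>c\<in>UNIV. ricci_mixed g x $ c $ b * u x $ c)
        = (\<Sum>c\<in>UNIV. \<Sum>a\<in>UNIV. ricci_matrix g x $ b $ a * (matrix_inv (g x) $ a $ c * u x $ c))"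
      by (simp add: ricci_mixed_eq matrix_matrix_mult_def sum_distrib_left ricci_matrix_sym[OF x,
          of b] ginv_sym[OF x, of _ "_"] mult_ac)
    also have "\<dots> = w b"
      by (subst sum.swap) (simp add: w_def V_def matrix_vector_mult_def sum_distrib_left)
    finally show ?thesis .
  qed
  have rho_u: "(transpose (rho c1 c2 lam g x) *v u x) $ b = (1 - c1 * c2) * w b
      + ((real CARD('n) - 1) * lam * c1 + c1 * c2 * scalar_curvature g x) * u x $ b" (is "_
          = _ + ?k * _") for b
  proof -
    have "rho c1 c2 lam g x $ c $ b * u x $ c =
        (1 - c1 * c2) * (ricci_mixed g x $ c $ b * u x $ c) + (if c = b then ?k * u x $ c else 0)"
        for c
      by (simp add: rho_def mat_def algebra_simps)
    then have "(\<Sum>c\<in>UNIV. rho c1 c2 lam g x $ c $ b * u x $ c) = (1 - c1 * c2) * w b + ?k * u x $ b"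
      by (simp add: sum.distrib sum_distrib_left[symmetric] Pu)
    then show ?thesis by (simp add: vector_matrix_mult_def mult.commute[of "u x $ _"])
  qed
  have "(transpose (rho c1 c2 lam g x) *v u x) $ b = - (c2 / 2) * partial b (scalar_curvature g) x"
      for b
    using main[of b] rho_u[of b] by (simp add: algebra_simps del: transpose_matrix_vector)
  then show ?thesis by (simp add: vec_eq_iff differential_def del: transpose_matrix_vector)
qed

end

text \<open>The candidate in a single chart, as a function of the metric components alone; its behaviour under
changes of coordinates can then be stated for two metrics on open subsets of coordinate space.\<close>

definition chart_candidate
    :: "real \<Rightarrow> real \<Rightarrow> real \<Rightarrow> (real^'n \<Rightarrow> real^'n^'n) \<Rightarrow> real^'n \<Rightarrow> real^'n::finite" where
  "chart_candidate c1 c2 lam g x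
      = - (c2 / 2) *\<^sub>R (rho_inv_flip c1 c2 lam g x *v differential (scalar_curvature g) x)"

lemma soliton_candidate_eq: "soliton_candidate g c1 c2 lam c x = chart_candidate c1 c2 lam (g c) x"
  by (simp add: soliton_candidate_def chart_candidate_def differential_def matrix_vector_mult_def
      vec_eq_iff)

context metric_on begin

lemma ricci_matrix_transpose: "x \<in> S \<Longrightarrow> transpose (ricci_matrix g x) = ricci_matrix g x"
  using ricci_matrix_sym by (simp add: transpose_def vec_eq_iff)

text \<open>With its first index lowered, \<open>\<rho>\<close> is a linear combination of the Ricci tensor and the metric, which are symmetric.\<close>

lemma rho_lowered_symmetric:
  assumes x: "x \<in> S"
  shows "g x ** rho c1 c2 lam g x = transpose (rho c1 c2 lam g x) ** g x"
proof -
  have 1: "g x ** ricci_mixed g x = transpose (ricci_mixed g x) ** g x"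
    using x by (simp add: ricci_mixed_eq matrix_transpose_mul ginv_transpose ricci_matrix_transpose
        matrix_mul_assoc[symmetric] ginv)
      (simp add: matrix_mul_assoc ginv)
  have s: "A ** (r *\<^sub>R B) = r *\<^sub>R (A ** B)" "(r *\<^sub>R A) ** B = r *\<^sub>R (A ** B)"
      for A B :: "real^'n^'n" and r
    by (simp_all add: matrix_matrix_mult_def vec_eq_iff sum_distrib_left mult_ac)
  show ?thesis
    by (simp add: rho_def matrix_add_ldistrib matrix_add_rdistrib transpose_add transpose_scalar s
        1)
qed

text \<open>Since \<open>\<rho>\<close> is self-adjoint, its inverse with flipped indices inverts the transpose of \<open>\<rho>\<close>, which is the
matrix in the linear equation.\<close>

lemma rho_inv_flip_transpose:
  assumes x: "x \<in> S" and det: "det (rho c1 c2 lam g x) \<noteq> 0"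
  shows "rho_inv_flip c1 c2 lam g x ** transpose (rho c1 c2 lam g x) = mat 1"
proof -
  let ?r = "rho c1 c2 lam g x"
  have r: "?r ** matrix_inv ?r = mat 1" using det matrix_inv_left_right invertible_det_nz by blast
  have "transpose ?r ** (g x ** matrix_inv ?r ** matrix_inv (g x))
      = (transpose ?r ** g x) ** matrix_inv ?r ** matrix_inv (g x)"
    by (simp only: matrix_mul_assoc)
  also have "\<dots> = g x ** (?r ** matrix_inv ?r) ** matrix_inv (g x)"
    by (simp only: rho_lowered_symmetric[OF x, symmetric] matrix_mul_assoc)
  also have "\<dots> = mat 1" by (simp add: r ginv x)
  finally show ?thesis unfolding rho_inv_flip_def using matrix_left_right_inverse by blast
qed

lemma soliton_is_candidate:
  fixes u :: "real^'n \<Rightarrow> real^'n"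
  assumes u: "\<And>a. smooth_on S (\<lambda>y. u y $ a)"
    and eq: "\<And>y a b. y \<in> S \<Longrightarrow>
      cov_deriv g u a b y = - c1 * u y $ a * u y $ b + c2 * ricci g a b y + lam * g y $ a $ b"
    and x: "x \<in> S" and det: "det (rho c1 c2 lam g x) \<noteq> 0"
  shows "u x = chart_candidate c1 c2 lam g x"
proof -
  have lin: "transpose (rho c1 c2 lam g x) *v u x
      = - (c2 / 2) *\<^sub>R differential (scalar_curvature g) x"
    using u eq x by (rule soliton_linear_equation)
  have "u x = (rho_inv_flip c1 c2 lam g x ** transpose (rho c1 c2 lam g x)) *v u x"
    by (simp add: rho_inv_flip_transpose[OF x det])
  also have "\<dots> = rho_inv_flip c1 c2 lam g x *v (transpose (rho c1 c2 lam g x) *v u x)"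
    by (simp only: matrix_vector_mul_assoc)
  also have "\<dots> = chart_candidate c1 c2 lam g x"
    unfolding lin chart_candidate_def by (simp only: matrix_vector_mult_scaleR)
  finally show ?thesis .
qed

lemma smooth_candidate:
  assumes det: "\<And>x. x \<in> S \<Longrightarrow> det (rho c1 c2 lam g x) \<noteq> 0"
  shows "smooth_on S (\<lambda>x. chart_candidate c1 c2 lam g x $ a)"
proof -
  have "smooth_matrix_on S (rho c1 c2 lam g)"
    unfolding smooth_matrix_on_def rho_def vector_add_component vector_scaleR_component
        real_scaleR_def
    by (intro allI smooth_on_add smooth_on_mult smooth_on_const open_S
        smooth_matrix_onD[OF smooth_ricci_mixed] smooth_scalar_curvature)
  then have "smooth_matrix_on S (\<lambda>x. rho_inv_flip c1 c2 lam g x)"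
    unfolding rho_inv_flip_def using det
    by (intro smooth_matrix_on_mult smooth_matrix_on_inv open_S smooth_g smooth_ginv) (auto
        simp: invertible_det_nz)
  then show ?thesis
    unfolding chart_candidate_def differential_def vector_scaleR_component real_scaleR_def
        matrix_vector_mult_def vec_lambda_beta
    by (intro smooth_on_mult smooth_on_sum smooth_on_const open_S smooth_on_partial
        smooth_scalar_curvature smooth_matrix_onD)
qed

end

section \<open>Change of coordinates\<close>

definition jacobian :: "(real^'n::finite \<Rightarrow> real^'n) \<Rightarrow> real^'n \<Rightarrow> real^'n^'n" where
  "jacobian \<phi> x = (\<chi> k i. partial i (\<lambda>y. \<phi> y $ k) x)"

text \<open>The situation of two overlapping charts, with \<open>\<phi>\<close> the change of coordinates on the overlap \<open>W\<close>. The
Jacobian of \<open>\<phi>\<close> is invertible because it pulls a nondegenerate metric back to a nondegenerate metric.\<close>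

locale local_isometry = source: metric_on S g + target: metric_on S' g'
  for S :: "(real^'n::finite) set" and g and S' :: "(real^'n) set" and g' +
  fixes W :: "(real^'n) set" and \<phi> :: "real^'n \<Rightarrow> real^'n"
  assumes open_W: "open W" and W_sub: "W \<subseteq> S"
    and \<phi>_maps: "x \<in> W \<Longrightarrow> \<phi> x \<in> S'"
    and smooth_\<phi>: "smooth_on W (\<lambda>x. \<phi> x $ k)"
    and pullback: "x \<in> W \<Longrightarrow> g x = transpose (jacobian \<phi> x) ** g' (\<phi> x) ** jacobian \<phi> x"
begin

abbreviation J where "J \<equiv> jacobian \<phi>"

text \<open>The connection matrices of \<open>g'\<close> pulled back as a one-form: only the form index is transformed, while the
matrix indices still refer to the frame of the target.\<close>

definition pulled_conn :: "'n \<Rightarrow> real^'n \<Rightarrow> real^'n^'n" where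
  "pulled_conn a x = (\<Sum>l\<in>UNIV. J x $ l $ a *\<^sub>R conn_matrix g' l (\<phi> x))"

lemma smooth_J: "smooth_matrix_on W J"
  by (simp add: smooth_matrix_on_def jacobian_def smooth_on_partial smooth_\<phi>)

lemma J_invertible:
  assumes x: "x \<in> W"
  shows "invertible (J x)"
proof -
  have "det (g x) \<noteq> 0" using source.invertible_g W_sub x invertible_det_nz by blast
  then show ?thesis by (simp add: pullback x det_mul invertible_det_nz)
qed

lemma J_deriv_sym: "x \<in> W \<Longrightarrow> matrix_partial a J x $ k $ b = matrix_partial b J x $ k $ a"
  by (simp add: matrix_partial_def jacobian_def partial_commute[OF open_W smooth_\<phi>])

lemma compose_chain:
  assumes f: "smooth_on S' f" and x: "x \<in> W"
  shows "(\<lambda>y. f (\<phi> y)) differentiable (at x)"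
    and "partial a (\<lambda>y. f (\<phi> y)) x = (\<Sum>l\<in>UNIV. J x $ l $ a * partial l f (\<phi> x))"
proof -
  have "f differentiable (at (\<phi> x))" using f target.open_S \<phi>_maps[OF x]
      by (rule smooth_on_differentiable)
  moreover have "(\<lambda>y. \<phi> y $ k) differentiable (at x)" for k
    using smooth_\<phi> open_W x by (rule smooth_on_differentiable)
  ultimately show "(\<lambda>y. f (\<phi> y)) differentiable (at x)"
    and "partial a (\<lambda>y. f (\<phi> y)) x = (\<Sum>l\<in>UNIV. J x $ l $ a * partial l f (\<phi> x))"
    unfolding jacobian_def vec_lambda_beta by (rule chain_rule_partial)+
qed

lemma matrix_compose_chain:
  assumes F: "smooth_matrix_on S' F" and x: "x \<in> W"
  shows "matrix_differentiable (\<lambda>y. F (\<phi> y)) x"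
    and "matrix_partial a (\<lambda>y. F (\<phi> y)) x = (\<Sum>l\<in>UNIV. J x $ l $ a *\<^sub>R matrix_partial l F (\<phi> x))"
  using compose_chain[OF smooth_matrix_onD[OF F] x]
  by (simp_all add: matrix_differentiable_def matrix_partial_def vec_eq_iff)

lemma scaleR_sum_mult:
  fixes A :: "'n \<Rightarrow> real^'n^'n"
  shows "(\<Sum>l\<in>UNIV. r l *\<^sub>R A l) ** B = (\<Sum>l\<in>UNIV. r l *\<^sub>R (A l ** B))"
    and "B ** (\<Sum>l\<in>UNIV. r l *\<^sub>R A l) = (\<Sum>l\<in>UNIV. r l *\<^sub>R (B ** A l))"
proof -
  show "(\<Sum>l\<in>UNIV. r l *\<^sub>R A l) ** B = (\<Sum>l\<in>UNIV. r l *\<^sub>R (A l ** B))"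
    by (simp add: vec_eq_iff matrix_matrix_mult_def sum_distrib_left sum_distrib_right mult.assoc)
        (intro allI sum.swap)
  show "B ** (\<Sum>l\<in>UNIV. r l *\<^sub>R A l) = (\<Sum>l\<in>UNIV. r l *\<^sub>R (B ** A l))"
    by (simp add: vec_eq_iff matrix_matrix_mult_def sum_distrib_left mult.left_commute) (intro allI
        sum.swap)
qed

text \<open>The transformation law \<open>J\<Gamma>\<^sub>a = \<partial>\<^sub>aJ + \<Gamma>'\<^sub>aJ\<close> of a connection under the change of frame \<open>J\<close>. The connection
matrices that it defines are compatible with the pulled back metric, and they are symmetric because
\<open>\<partial>\<^sub>aJ\<^sup>k\<^sub>b\<close> is a second derivative; hence they are the Christoffel symbols.\<close>

lemma conn_transform:
  assumes x: "x \<in> W"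
  shows "J x ** conn_matrix g a x = matrix_partial a J x + pulled_conn a x ** J x"
proof -
  define E where "E a = matrix_partial a J x + pulled_conn a x ** J x" for a
  define C where "C a = matrix_inv (J x) ** E a" for a
  have JC: "J x ** C a = E a" for a
    by (simp add: C_def matrix_mul_assoc matrix_inv_left_right J_invertible x)
  have "E a $ k $ b = E b $ k $ a" for a b k
  proof -
    have "(pulled_conn a x ** J x) $ k $ b
        = (\<Sum>m\<in>UNIV. \<Sum>l\<in>UNIV. J x $ l $ a * conn_matrix g' l (\<phi> x) $ k $ m * J x $ m $ b)" for a b
      by (simp add: pulled_conn_def matrix_matrix_mult_def sum_distrib_right)
    moreover have "(\<Sum>m\<in>UNIV. \<Sum>l\<in>UNIV. J x $ l $ a * conn_matrix g' l (\<phi> x) $ k $ m * J x $ m $ b) =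
        (\<Sum>m\<in>UNIV. \<Sum>l\<in>UNIV. J x $ l $ b * conn_matrix g' l (\<phi> x) $ k $ m * J x $ m $ a)"
      by (subst sum.swap) (intro sum.cong refl, simp add: target.torsion_free[OF \<phi>_maps[OF x]]
          mult_ac)
    ultimately show ?thesis by (simp add: E_def J_deriv_sym[OF x, of a])
  qed
  then have sym: "C a $ c $ b = C b $ c $ a" for a b c
    by (simp add: C_def matrix_matrix_mult_def)
  have "matrix_partial a g x = transpose (C a) ** g x + g x ** C a" for a
  proof -
    let ?g' = "g' (\<phi> x)"
    have dg': "matrix_partial a (\<lambda>y. g' (\<phi> y)) x = transpose (pulled_conn a x) ** ?g'
        + ?g' ** pulled_conn a x"
    proof -
      have t: "transpose (pulled_conn a x)
          = (\<Sum>l\<in>UNIV. J x $ l $ a *\<^sub>R transpose (conn_matrix g' l (\<phi> x)))"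
        by (simp add: pulled_conn_def transpose_def vec_eq_iff)
      show ?thesis
        unfolding t matrix_compose_chain(2)[OF target.smooth_g x]
        unfolding pulled_conn_def scaleR_sum_mult
        by (simp add: target.metric_compatible[OF \<phi>_maps[OF x]] scaleR_add_right sum.distrib)
    qed
    have dJ: "matrix_differentiable J x" using smooth_J open_W x
        by (rule smooth_matrix_on_differentiable)
    have "matrix_partial a g x = matrix_partial a (\<lambda>y. transpose (J y) ** g' (\<phi> y) ** J y) x"
      using open_W x pullback by (rule matrix_partial_cong)
    also have "\<dots> = transpose (E a) ** ?g' ** J x + transpose (J x) ** ?g' ** E a"
      unfolding E_def
      by (simp add: matrix_partial_mult matrix_differentiable_mult matrix_differentiable_transpose
          dJ dg'
          matrix_compose_chain(1)[OF target.smooth_g x] matrix_partial_transpose transpose_add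
          matrix_transpose_mul matrix_ring_simps)
    also have "\<dots> = transpose (C a) ** g x + g x ** C a"
      by (simp add: JC[symmetric] pullback[OF x] matrix_transpose_mul matrix_mul_assoc)
    finally show ?thesis .
  qed
  then have "C a = conn_matrix g a x" using source.levi_civita_unique[OF _ sym] W_sub x by blast
  then show ?thesis using JC[of a] by (simp add: E_def)
qed

text \<open>The curvature of the pulled back connection, in the frame of the target.\<close>

definition pulled_curv :: "'n \<Rightarrow> 'n \<Rightarrow> real^'n \<Rightarrow> real^'n^'n" where
  "pulled_curv a b x = matrix_partial a (pulled_conn b) x - matrix_partial b (pulled_conn a) x
     + pulled_conn a x ** pulled_conn b x - pulled_conn b x ** pulled_conn a x"

lemma pulled_conn_derivative:
  assumes x: "x \<in> W"
  shows "matrix_differentiable (pulled_conn b) x"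
    and "matrix_partial a (pulled_conn b) x
        = (\<Sum>l\<in>UNIV. matrix_partial a J x $ l $ b *\<^sub>R conn_matrix g' l (\<phi> x))
      + (\<Sum>l\<in>UNIV. \<Sum>p\<in>UNIV. (J x $ l $ a * J x $ p $ b) *\<^sub>R matrix_partial l (conn_matrix g' p) (\<phi> x))"
proof -
  note dc = compose_chain[OF smooth_matrix_onD[OF target.smooth_conn] x]
  have dJ: "(\<lambda>y. J y $ l $ b) differentiable (at x)" for l b
    using smooth_on_differentiable[OF smooth_matrix_onD[OF smooth_J] open_W x] .
  show "matrix_differentiable (pulled_conn b) x"
    unfolding matrix_differentiable_def pulled_conn_def by (simp add: dc dJ)
  have sw: "(\<Sum>l\<in>UNIV. \<Sum>p\<in>UNIV. J x $ l $ b * (J x $ p $ a * F l p))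
      = (\<Sum>l\<in>UNIV. \<Sum>p\<in>UNIV. J x $ l $ a * J x $ p $ b * F p l)"
    for F :: "'n \<Rightarrow> 'n \<Rightarrow> real"
    by (subst sum.swap) (simp add: mult_ac)
  show "matrix_partial a (pulled_conn b) x
      = (\<Sum>l\<in>UNIV. matrix_partial a J x $ l $ b *\<^sub>R conn_matrix g' l (\<phi> x))
      + (\<Sum>l\<in>UNIV. \<Sum>p\<in>UNIV. (J x $ l $ a * J x $ p $ b) *\<^sub>R matrix_partial l (conn_matrix g' p) (\<phi> x))"
    by (simp add: vec_eq_iff matrix_partial_def pulled_conn_def partial_sum partial_mult dc dJ
        sum.distrib sum_distrib_left sw)
qed

text \<open>Differentiating the transformation law of the connection and skew-symmetrising removes the second
derivatives of \<open>J\<close>.\<close>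

lemma gauge_curv:
  assumes x: "x \<in> W"
  shows "J x ** curv_matrix g a b x = pulled_curv a b x ** J x"
proof -
  let ?G = "\<lambda>a. conn_matrix g a x" and ?H = "\<lambda>a. pulled_conn a x"
      and ?dJ = "\<lambda>a. matrix_partial a J x"
  have dJ: "matrix_differentiable J x" using smooth_J open_W x
      by (rule smooth_matrix_on_differentiable)
  have ddJ: "matrix_differentiable (matrix_partial b J) x" for b
    using smooth_matrix_on_partial[OF smooth_J] open_W x by (rule smooth_matrix_on_differentiable)
  have dG: "matrix_differentiable (conn_matrix g b) x" for b using source.diff_conn W_sub x by blast
  have dJ': "?dJ a = J x ** ?G a - ?H a ** J x" for a
    by (simp add: conn_transform[OF x])
  have *: "J x ** matrix_partial a (conn_matrix g b) x = matrix_partial a (matrix_partial b J) x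
      + matrix_partial a (pulled_conn b) x ** J x + ?H b ** ?dJ a - ?dJ a ** ?G b" for a b
  proof -
    have "matrix_partial a (\<lambda>y. J y ** conn_matrix g b y) x
        = matrix_partial a (\<lambda>y. matrix_partial b J y + pulled_conn b y ** J y) x"
      using open_W x conn_transform by (rule matrix_partial_cong)
    then show ?thesis
      by (simp add: matrix_partial_add matrix_partial_mult matrix_differentiable_mult dJ ddJ dG
          pulled_conn_derivative(1)[OF x] algebra_simps)
  qed
  show ?thesis
    unfolding curv_eq pulled_curv_def matrix_ring_simps
    unfolding * dJ' using matrix_partial_commute[OF open_W smooth_J x, of a b]
    by (simp add: matrix_ring_simps algebra_simps)
qed

text \<open>Taking curvature commutes with pulling back: the derivatives of \<open>J\<close> in \<open>pulled_conn_derivative\<close> are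
symmetric in \<open>a\<close> and \<open>b\<close> and drop out.\<close>

lemma pulled_curv_eq:
  assumes x: "x \<in> W"
  shows "pulled_curv a b x
      = (\<Sum>l\<in>UNIV. \<Sum>p\<in>UNIV. (J x $ l $ a * J x $ p $ b) *\<^sub>R curv_matrix g' l p (\<phi> x))"
proof -
  have mul: "pulled_conn a x ** pulled_conn b x =
      (\<Sum>l\<in>UNIV. \<Sum>p\<in>UNIV. (J x $ l $ a * J x $ p $ b) *\<^sub>R (conn_matrix g' l (\<phi> x)
          ** conn_matrix g' p (\<phi> x)))" for a b
    unfolding pulled_conn_def scaleR_sum_mult(1) unfolding scaleR_sum_mult(2)
    by (simp add: scaleR_sum_right)
  have sw: "(\<Sum>l\<in>UNIV. \<Sum>p\<in>UNIV. (J x $ l $ b * J x $ p $ a) *\<^sub>R F l p)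
      = (\<Sum>l\<in>UNIV. \<Sum>p\<in>UNIV. (J x $ l $ a * J x $ p $ b) *\<^sub>R F p l)"
    for F :: "'n \<Rightarrow> 'n \<Rightarrow> real^'n^'n"
    by (subst sum.swap) (simp add: mult.commute)
  show ?thesis
    unfolding pulled_curv_def pulled_conn_derivative(2)[OF x] mul sw[where F =
        "\<lambda>l p. matrix_partial l (conn_matrix g' p) (\<phi> x)"]
      sw[where F = "\<lambda>l p. conn_matrix g' l (\<phi> x) ** conn_matrix g' p (\<phi> x)"] curv_eq
    by (simp add: J_deriv_sym[OF x, of a _ b] scaleR_diff_right scaleR_add_right sum.distrib
        sum_subtractf)
qed

text \<open>The trace pairs a form index, transformed by \<open>J\<close>, with a matrix index, transformed by the inverse of \<open>J\<close>.\<close>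

lemma ricci_matrix_transform:
  assumes x: "x \<in> W"
  shows "ricci_matrix g x = transpose (J x) ** ricci_matrix g' (\<phi> x) ** J x"
proof -
  let ?I = "matrix_inv (J x)"
  have I: "J x ** ?I = mat 1" "?I ** J x = mat 1"
    using matrix_inv_left_right J_invertible x by auto
  have conj: "curv_matrix g a b x = ?I ** (pulled_curv a b x ** J x)" for a b
    by (simp add: gauge_curv[OF x, symmetric] matrix_mul_assoc I)
  define Y where "Y l b = (\<Sum>p\<in>UNIV. J x $ p $ b *\<^sub>R (curv_matrix g' l p (\<phi> x) ** J x))" for l b
  have Z: "pulled_curv a b x ** J x = (\<Sum>l\<in>UNIV. J x $ l $ a *\<^sub>R Y l b)" for a b
    by (simp add: pulled_curv_eq[OF x] Y_def scaleR_sum_mult[symmetric] scaleR_sum_right[symmetric]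
        scaleR_scaleR[symmetric] del: scaleR_scaleR)
  have "ricci_matrix g x $ b $ d = (transpose (J x) ** ricci_matrix g' (\<phi> x) ** J x) $ b $ d"
      for b d
  proof -
    have "ricci_matrix g x $ b $ d
        = (\<Sum>a\<in>UNIV. \<Sum>k\<in>UNIV. \<Sum>l\<in>UNIV. ?I $ a $ k * (J x $ l $ a * Y l b $ k $ d))"
      by (simp add: ricci_matrix_eq conj Z) (simp add: matrix_matrix_mult_def sum_distrib_left)
    also have "\<dots> = (\<Sum>k\<in>UNIV. \<Sum>l\<in>UNIV. \<Sum>a\<in>UNIV. ?I $ a $ k * (J x $ l $ a * Y l b $ k $ d))"
      by (rule sum_rotate)
    also have "\<dots> = (\<Sum>k\<in>UNIV. \<Sum>l\<in>UNIV. (J x ** ?I) $ l $ k * Y l b $ k $ d)"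
      by (simp add: matrix_matrix_mult_def sum_distrib_left mult_ac)
    also have "\<dots> = (\<Sum>k\<in>UNIV. Y k b $ k $ d)"
      by (simp add: I mat_def if_distrib[of "\<lambda>z. z * _"] cong: if_cong)
    also have "\<dots> = (\<Sum>k\<in>UNIV. \<Sum>p\<in>UNIV. \<Sum>m\<in>UNIV. J x $ p $ b * (curv_matrix g' k p (\<phi> x) $ k $ m * J x $ m $ d))"
      by (simp add: Y_def matrix_matrix_mult_def sum_distrib_left)
    also have "\<dots> = (\<Sum>p\<in>UNIV. \<Sum>m\<in>UNIV. \<Sum>k\<in>UNIV. J x $ p $ b * (curv_matrix g' k p (\<phi> x) $ k $ m * J x $ m $ d))"
      by (rule sum_rotate)
    also have "\<dots> = (\<Sum>p\<in>UNIV. \<Sum>m\<in>UNIV. J x $ p $ b * ricci_matrix g' (\<phi> x) $ p $ m * J x $ m $ d)"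
      by (simp add: ricci_matrix_eq sum_distrib_left sum_distrib_right mult_ac)
    also have "\<dots> = (transpose (J x) ** ricci_matrix g' (\<phi> x) ** J x) $ b $ d"
      by (subst sum.swap) (simp add: matrix_matrix_mult_def transpose_def sum_distrib_right)
    finally show ?thesis .
  qed
  then show ?thesis by (simp add: vec_eq_iff)
qed

lemma ginv_transform:
  assumes x: "x \<in> W"
  shows "matrix_inv (g x) = matrix_inv (J x) ** matrix_inv (g' (\<phi> x))
      ** transpose (matrix_inv (J x))"
proof (rule matrix_inv_unique)
  let ?I = "matrix_inv (J x)" and ?g' = "g' (\<phi> x)"
  have I: "J x ** ?I = mat 1" "?I ** J x = mat 1"
    using matrix_inv_left_right J_invertible x by auto
  have It: "transpose (J x) ** transpose ?I = mat 1"
    by (simp add: matrix_transpose_mul[symmetric] I)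
  have "g x ** (?I ** matrix_inv ?g' ** transpose ?I)
     = transpose (J x) ** (?g' ** (J x ** ?I) ** matrix_inv ?g') ** transpose ?I"
    by (simp only: pullback[OF x] matrix_mul_assoc)
  also have "\<dots> = mat 1" by (simp add: I It target.ginv \<phi>_maps x)
  finally show "g x ** (?I ** matrix_inv ?g' ** transpose ?I) = mat 1" .
qed

lemma ricci_mixed_transform:
  assumes x: "x \<in> W"
  shows "ricci_mixed g x = matrix_inv (J x) ** ricci_mixed g' (\<phi> x) ** J x"
proof -
  let ?I = "matrix_inv (J x)"
  have It: "transpose ?I ** transpose (J x) = mat 1"
    by (simp add: matrix_transpose_mul[symmetric] matrix_inv_left_right(1)[OF J_invertible[OF x]])
  have "ricci_mixed g x = ?I ** matrix_inv (g' (\<phi> x)) ** (transpose ?I ** transpose (J x))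
      ** ricci_matrix g' (\<phi> x) ** J x"
    by (simp only: ricci_mixed_eq ricci_matrix_transform[OF x] ginv_transform[OF x]
        matrix_mul_assoc)
  then show ?thesis by (simp add: It ricci_mixed_eq matrix_mul_assoc)
qed

lemma scalar_curvature_invariant:
  assumes x: "x \<in> W"
  shows "scalar_curvature g x = scalar_curvature g' (\<phi> x)"
proof -
  have "scalar_curvature g x = trace (matrix_inv (J x) ** (ricci_mixed g' (\<phi> x) ** J x))"
    using W_sub x source.scalar_curvature_trace
        by (simp add: subset_iff trace_def ricci_mixed_transform matrix_mul_assoc)
  also have "\<dots> = trace (ricci_mixed g' (\<phi> x) ** (J x ** matrix_inv (J x)))"
    by (subst trace_mul_sym) (simp only: matrix_mul_assoc)
  also have "\<dots> = scalar_curvature g' (\<phi> x)"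
    using x by (simp add: matrix_inv_left_right J_invertible target.scalar_curvature_trace \<phi>_maps
        trace_def)
  finally show ?thesis .
qed

lemma rho_transform:
  assumes x: "x \<in> W"
  shows "rho c1 c2 lam g x = matrix_inv (J x) ** rho c1 c2 lam g' (\<phi> x) ** J x"
proof -
  have s: "A ** (r *\<^sub>R B) = r *\<^sub>R (A ** B)" "(r *\<^sub>R A) ** B = r *\<^sub>R (A ** B)"
      for A B :: "real^'n^'n" and r
    by (simp_all add: matrix_matrix_mult_def vec_eq_iff sum_distrib_left mult_ac)
  show ?thesis
    using x by (simp add: rho_def ricci_mixed_transform scalar_curvature_invariant
        matrix_add_ldistrib matrix_add_rdistrib s
      matrix_inv_left_right J_invertible)
qed

lemma differential_transform:
  assumes x: "x \<in> W"
  shows "differential (scalar_curvature g) x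
      = transpose (J x) *v differential (scalar_curvature g') (\<phi> x)"
proof -
  have "partial b (scalar_curvature g) x = partial b (\<lambda>y. scalar_curvature g' (\<phi> y)) x" for b
    using open_W x scalar_curvature_invariant by (rule partial_cong)
  then show ?thesis
    by (simp add: differential_def vec_eq_iff compose_chain(2)[OF target.smooth_scalar_curvature x]
        vector_matrix_mult_def mult.commute)
qed

lemma candidate_transform:
  assumes x: "x \<in> W" and det: "det (rho c1 c2 lam g' (\<phi> x)) \<noteq> 0"
  shows "chart_candidate c1 c2 lam g x = transpose (J x) *v chart_candidate c1 c2 lam g' (\<phi> x)"
proof -
  let ?I = "matrix_inv (J x)" and ?r = "rho c1 c2 lam g' (\<phi> x)"
  have I: "J x ** ?I = mat 1" "?I ** J x = mat 1"
    using matrix_inv_left_right J_invertible x by auto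
  have It: "transpose ?I ** transpose (J x) = mat 1"
    by (simp add: matrix_transpose_mul[symmetric] I)
  have r: "?r ** matrix_inv ?r = mat 1" using det matrix_inv_left_right invertible_det_nz by blast
  have ri: "matrix_inv (rho c1 c2 lam g x) = ?I ** matrix_inv ?r ** J x"
  proof (rule matrix_inv_unique)
    have "rho c1 c2 lam g x ** (?I ** matrix_inv ?r ** J x)
        = ?I ** (?r ** (J x ** ?I) ** matrix_inv ?r) ** J x"
      by (simp only: rho_transform[OF x] matrix_mul_assoc)
    then show "rho c1 c2 lam g x ** (?I ** matrix_inv ?r ** J x) = mat 1" by (simp add: I r)
  qed
  have "rho_inv_flip c1 c2 lam g x ** transpose (J x) =
     transpose (J x) ** g' (\<phi> x) ** (J x ** ?I) ** matrix_inv ?r ** (J x ** ?I)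
         ** matrix_inv (g' (\<phi> x)) ** (transpose ?I ** transpose (J x))"
    unfolding rho_inv_flip_def ri ginv_transform[OF x] unfolding pullback[OF x]
        by (simp only: matrix_mul_assoc)
  also have "\<dots> = transpose (J x) ** rho_inv_flip c1 c2 lam g' (\<phi> x)"
    by (simp add: I It rho_inv_flip_def matrix_mul_assoc)
  finally show ?thesis
    unfolding chart_candidate_def differential_transform[OF x]
    by (simp only: matrix_vector_mult_scaleR matrix_vector_mul_assoc)
qed

end

section \<open>Gradient solitons on a manifold\<close>

lemma metric_on_chart:
  assumes "smooth_manifold M A" "pseudo_riemannian_metric A g" "c \<in> A"
  shows "metric_on (chart_image c) (g c)"
  using assms
  by unfold_locales (auto simp: smooth_manifold_def chart_of_def pseudo_riemannian_metric_def
      smooth_matrix_on_def)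

lemma open_overlap:
  assumes M: "smooth_manifold M A" and c: "c \<in> A" and d: "d \<in> A"
  shows "open (overlap c d)"
proof -
  have op: "openin M (fst c)" "openin M (fst d)" "open (chart_image c)"
    and h: "homeomorphic_map (subtopology M (fst c)) (top_of_set (chart_image c)) (snd c)"
    using M c d by (auto simp: smooth_manifold_def chart_of_def)
  have "openin (subtopology M (fst c)) (fst c \<inter> fst d)"
    using op(2) by (metis Int_commute openin_subtopology_Int2)
  then have "openin (top_of_set (chart_image c)) (overlap c d)"
    unfolding overlap_def using h homeomorphic_imp_open_map open_map_def by blast
  then show ?thesis using op(3) openin_open_trans by blast
qed

lemma transition_in_chart:
  assumes "x \<in> overlap c d" "inj_on (snd c) (fst c)"
  shows "transition c d x \<in> chart_image d"
  using assms by (auto simp: overlap_def transition_def chart_image_def)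

lemma chart_inj:
  assumes M: "smooth_manifold M A" and c: "c \<in> A"
  shows "inj_on (snd c) (fst c)"
proof -
  have op: "openin M (fst c)"
    and h: "homeomorphic_map (subtopology M (fst c)) (top_of_set (chart_image c)) (snd c)"
    using M c by (auto simp: smooth_manifold_def chart_of_def)
  have "topspace (subtopology M (fst c)) = fst c" using openin_subset[OF op] by auto
  then show ?thesis using homeomorphic_imp_injective_map[OF h] by simp
qed

lemma transition_isometry:
  assumes M: "smooth_manifold M A" and g: "pseudo_riemannian_metric A g" and c: "c \<in> A"
      and d: "d \<in> A"
  shows "local_isometry (chart_image c) (g c) (chart_image d) (g d) (overlap c d) (transition c d)"
proof -
  interpret source: metric_on "chart_image c" "g c" using M g c by (rule metric_on_chart)
  interpret target: metric_on "chart_image d" "g d" using M g d by (rule metric_on_chart)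
  show ?thesis
  proof
    show "open (overlap c d)" using M c d by (rule open_overlap)
    show "overlap c d \<subseteq> chart_image c" by (auto simp: overlap_def chart_image_def)
    show "transition c d x \<in> chart_image d" if "x \<in> overlap c d" for x
      using that chart_inj[OF M c] by (rule transition_in_chart)
    show "smooth_on (overlap c d) (\<lambda>x. transition c d x $ k)" for k
      using M c d by (auto simp: smooth_manifold_def)
    fix x assume x: "x \<in> overlap c d"
    have "g c x $ a $ b = (\<Sum>k\<in>UNIV. \<Sum>l\<in>UNIV.
          jac c d k a x * jac c d l b x * g d (transition c d x) $ k $ l)" for a b
      using g c d x unfolding pseudo_riemannian_metric_def by blast
    also have "\<dots> a b = (\<Sum>l\<in>UNIV. \<Sum>k\<in>UNIV.
          jac c d k a x * jac c d l b x * g d (transition c d x) $ k $ l)" for a b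
      by (rule sum.swap)
    finally show "g c x = transpose (jacobian (transition c d) x) ** g d (transition c d x)
        ** jacobian (transition c d) x"
      by (simp add: vec_eq_iff matrix_matrix_mult_def transpose_def jacobian_def jac_def
          sum_distrib_left mult_ac)
  qed
qed

theorem proposition4p1:
  fixes M :: "'a topology"
    and A :: "('a, 'n::finite) chart set"
    and g :: "('a, 'n) bilinear_field"
    and c1 c2 lam :: real
  assumes "smooth_manifold M A"
    and "pseudo_riemannian_metric A g"
    and "\<forall>c\<in>A. \<forall>x\<in>chart_image c. det (rho c1 c2 lam (g c) x) \<noteq> 0"
  shows "(\<forall>X. gradient_soliton A g c1 c2 lam X \<longrightarrow>
            (\<forall>c\<in>A. \<forall>x\<in>chart_image c. X c x = soliton_candidate g c1 c2 lam c x))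
       \<and> (gradient_soliton A g c1 c2 lam (soliton_candidate g c1 c2 lam) \<longleftrightarrow>
            (\<forall>c\<in>A. \<forall>x\<in>chart_image c. \<forall>a b.
               cov_deriv (g c) (soliton_candidate g c1 c2 lam c) a b x =
                 - c1 * soliton_candidate g c1 c2 lam c x $ a * soliton_candidate g c1 c2 lam c x $ b
                 + c2 * ricci (g c) a b x + lam * g c x $ a $ b))"
proof -
  let ?Y = "soliton_candidate g c1 c2 lam"
  note chart = metric_on_chart[OF assms(1,2)]
  have eq: "cov_deriv (g c) (X c) a b x = - c1 * X c x $ a * X c x $ b + c2 * ricci (g c) a b x
      + lam * g c x $ a $ b"
    if "gradient_soliton A g c1 c2 lam X" "c \<in> A" "x \<in> chart_image c" for X c x a b
  proof -
    have "(cov_deriv (g c) (X c) a b x + cov_deriv (g c) (X c) b a x) / 2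
        + c1 * X c x $ a * X c x $ b - c2 * ricci (g c) a b x = lam * g c x $ a $ b"
      and "(cov_deriv (g c) (X c) a b x - cov_deriv (g c) (X c) b a x) / 2 = 0"
      using that unfolding gradient_soliton_def generalised_ricci_soliton_def by blast+
    then show ?thesis by simp
  qed
  have unique: "X c x = ?Y c x"
    if X: "gradient_soliton A g c1 c2 lam X" and c: "c \<in> A" and x: "x \<in> chart_image c" for X c x
  proof -
    interpret metric_on "chart_image c" "g c" using c by (rule chart)
    have "smooth_on (chart_image c) (\<lambda>x. X c x $ a)" for a
      using X c unfolding gradient_soliton_def generalised_ricci_soliton_def one_form_def by blast
    then show ?thesis
      unfolding soliton_candidate_eq using eq[OF X c] x assms(3) c
          by (intro soliton_is_candidate) auto
  qed
  have one_form: "one_form A ?Y"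
    unfolding one_form_def
  proof (intro conjI ballI allI)
    fix c a assume c: "c \<in> A"
    interpret metric_on "chart_image c" "g c" using c by (rule chart)
    show "smooth_on (chart_image c) (\<lambda>x. ?Y c x $ a)"
      unfolding soliton_candidate_eq using assms(3) c by (intro smooth_candidate) auto
  next
    fix c d x a assume c: "c \<in> A" and d: "d \<in> A" and x: "x \<in> overlap c d"
    interpret local_isometry "chart_image c" "g c" "chart_image d" "g d" "overlap c d"
        "transition c d"
      using assms(1,2) c d by (rule transition_isometry)
    have "det (rho c1 c2 lam (g d) (transition c d x)) \<noteq> 0" using assms(3) d \<phi>_maps[OF x] by blast
    from candidate_transform[OF x this]
    show "?Y c x $ a = (\<Sum>k\<in>UNIV. jac c d k a x * ?Y d (transition c d x) $ k)"
      by (simp add: soliton_candidate_eq vector_matrix_mult_def jacobian_def jac_def mult.commute)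
  qed
  have soliton: "gradient_soliton A g c1 c2 lam ?Y"
    if *: "\<forall>c\<in>A. \<forall>x\<in>chart_image c. \<forall>a b. cov_deriv (g c) (?Y c) a b x =
      - c1 * ?Y c x $ a * ?Y c x $ b + c2 * ricci (g c) a b x + lam * g c x $ a $ b"
    unfolding gradient_soliton_def generalised_ricci_soliton_def
  proof (intro conjI one_form ballI allI)
    fix c x a b assume c: "c \<in> A" and x: "x \<in> chart_image c"
    interpret metric_on "chart_image c" "g c" using c by (rule chart)
    have cov: "cov_deriv (g c) (?Y c) a b x = - c1 * ?Y c x $ a * ?Y c x $ b
        + c2 * ricci (g c) a b x + lam * g c x $ a $ b" for a b
      using * c x by blast
    have r: "ricci (g c) b a x = ricci (g c) a b x" using ricci_matrix_sym[OF x, of a b]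
        by (simp add: ricci_matrix_def)
    show "(cov_deriv (g c) (?Y c) a b x + cov_deriv (g c) (?Y c) b a x) / 2
        + c1 * ?Y c x $ a * ?Y c x $ b - c2 * ricci (g c) a b x = lam * g c x $ a $ b"
      unfolding cov r g_sym[OF x, of b] by (simp add: field_simps)
    show "(cov_deriv (g c) (?Y c) a b x - cov_deriv (g c) (?Y c) b a x) / 2 = 0"
      unfolding cov r g_sym[OF x, of b] by simp
  qed
  show ?thesis using unique eq soliton by blast
qed

end
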